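(* There exist a real $3\times 3$ matrix-valued function $A(x,y,t)$ on $\mathbb{T}^2\times\mathbb{R}^+$, which is uniformly elliptic and uniformly $C^1$ (its entries and their first partial derivatives in $x,y,t$ are continuous and bounded), and a non-zero real function $u$ on $\mathbb{T}^2\times\mathbb{R}^+$ which is uniformly $C^2$ (all partial derivatives of order at most $2$ are continuous and bounded), such that $$\operatorname{div}(A\nabla u)=0 \quad\text{in } \mathbb{T}^2\times\mathbb{R}^+,$$ and $u$ has double exponential decay: there are numerical constants $c,C>0$ such that for all sufficiently large $T$, $$\sup_{\mathbb{T}^2\times\{t\ge T\}}|u(x,y,t)|\le Ce^{-ce^{cT}}.$$
   Context: $\mathbb{T}^2=(\mathbb{R}/2\pi\mathbb{Z})^2$ with periodic coordinates $(x,y)$; $t$ denotes the third (non-periodic) coordinate of the cylinder $\mathbb{T}^2\times\mathbb{R}^+$. Here $\nabla$ and $\operatorname{div}$ are taken in all three variables $(x,y,t)$. Uniform ellipticity means there is $\Lambda\ge1$ with $\Lambda^{-1}|\xi|^2\le \xi^TA\xi\le\Lambda|\xi|^2$ for all $\xi\in\mathbb{R}^3$ and all points. *)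

theory Defs
  imports "HOL-Analysis.Analysis"
begin

text \<open>Points of the cylinder: p :: real^3 with p$1 = x, p$2 = y, p$3 = t.
  The cylinder T^2 x R^+ is modelled as the half space t > 0 together with
  2 pi-periodicity of all functions in x and y.\<close>

definition cyl :: "(real^3) set" where
  "cyl = {p. p $ 3 > 0}"

definition periodic_xy :: "(real^3 \<Rightarrow> 'b) \<Rightarrow> bool" where
  "periodic_xy f \<longleftrightarrow> (\<forall>p. f (p + (2*pi) *\<^sub>R axis 1 1) = f p \<and> f (p + (2*pi) *\<^sub>R axis 2 1) = f p)"

definition pd :: "3 \<Rightarrow> (real^3 \<Rightarrow> real) \<Rightarrow> real^3 \<Rightarrow> real" where
  "pd k f p = deriv (\<lambda>s. f (p + s *\<^sub>R axis k 1)) 0"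

definition uniformly_C1_on :: "(real^3) set \<Rightarrow> (real^3 \<Rightarrow> real) \<Rightarrow> bool" where
  "uniformly_C1_on S f \<longleftrightarrow> continuous_on S f \<and> bounded (f ` S) \<and>
     (\<forall>k. (\<forall>p\<in>S. (\<lambda>s. f (p + s *\<^sub>R axis k 1)) differentiable (at 0))
          \<and> continuous_on S (pd k f) \<and> bounded (pd k f ` S))"

definition uniformly_C2_on :: "(real^3) set \<Rightarrow> (real^3 \<Rightarrow> real) \<Rightarrow> bool" where
  "uniformly_C2_on S f \<longleftrightarrow> uniformly_C1_on S f \<and> (\<forall>k. uniformly_C1_on S (pd k f))"

definition uniformly_elliptic_on :: "(real^3) set \<Rightarrow> (real^3 \<Rightarrow> real^3^3) \<Rightarrow> bool" where
  "uniformly_elliptic_on S A \<longleftrightarrow> (\<exists>\<Lambda>\<ge>1. \<forall>p\<in>S. \<forall>\<xi>::real^3.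
     (norm \<xi>)\<^sup>2 / \<Lambda> \<le> \<xi> \<bullet> (A p *v \<xi>) \<and> \<xi> \<bullet> (A p *v \<xi>) \<le> \<Lambda> * (norm \<xi>)\<^sup>2)"

definition div_A_grad :: "(real^3 \<Rightarrow> real^3^3) \<Rightarrow> (real^3 \<Rightarrow> real) \<Rightarrow> real^3 \<Rightarrow> real" where
  "div_A_grad A u p = (\<Sum>i\<in>UNIV. pd i (\<lambda>q. \<Sum>j\<in>UNIV. A q $ i $ j * pd j u q) p)"

end

theory Submission
  imports Defs
begin

(* The solution passes through stages k = 0, 1, 2, ... of length 5. In stage k a mode
   f(t) cos(n x) with n = 1000 * 2^k is replaced by a mode g(t) cos(2 n y); the next stage does the
   same with x and y exchanged and n doubled. As the frequency doubles in each stage, the decay is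
   doubly exponential. A mode exp(- n p(t)) cos(n x) solves the equation with the diagonal
   coefficient a = p'^2 - p''/n in the x-direction, so increasing p' makes the old mode decay faster
   than the new one, although its frequency is lower. Switching on the new mode while it is
   small compared with the old one, and switching off the old one after it has become small compared
   with the new one, causes errors that are absorbed into oscillating perturbations of the
   coefficients. The matrix need not be symmetric, and hence a perturbation can be
   chosen that acts on the gradient of the dominant mode only and maps it to a field with
   divergence proportional to the other mode, so that the equation becomes a linear system for f and g:
     f'' = alpha^2 a f + (alpha beta / 2) mu g,   g'' = beta^2 b g + (alpha beta / 2) kappa f. *)

section \<open>A step function of class C^3 with explicit derivatives\<close>

text \<open>This is the degree 7 polynomial step, with four vanishing orders at both ends. The
  powers of \<open>t - 1\<close> cancel it against the constant 1 beyond \<open>t = 1\<close>, so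
  truncated powers give one formula for all \<open>t\<close>. Three continuous derivatives are
  required because the matrix entries contain second derivatives of the step and must themselves be
  C^1.\<close>

definition smoothstep :: "real \<Rightarrow> real" where
  "smoothstep t = 35 * max 0 t ^ 4 - 84 * max 0 t ^ 5 + 70 * max 0 t ^ 6 - 20 * max 0 t ^ 7
     + 35 * max 0 (t - 1) ^ 4 + 84 * max 0 (t - 1) ^ 5 + 70 * max 0 (t - 1) ^ 6 + 20 * max 0 (t - 1) ^ 7"

text \<open>The factored form makes the sign and the support in [0, 1] visible; truncating the
  product t (1 - t) replaces the case distinction.\<close>

definition smoothstep1 :: "real \<Rightarrow> real" where
  "smoothstep1 t = 140 * max 0 (t * (1 - t)) ^ 3"

definition smoothstep2 :: "real \<Rightarrow> real" where
  "smoothstep2 t = 420 * max 0 (t * (1 - t)) ^ 2 * (1 - 2 * t)"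

definition smoothstep3 :: "real \<Rightarrow> real" where
  "smoothstep3 t = 840 * max 0 (t * (1 - t)) * (1 - 2 * t)\<^sup>2 - 840 * max 0 (t * (1 - t)) ^ 2"

text \<open>From exponent 2 on the kink at 0 does no harm: the difference quotient there is the
  truncated power of one order less, which tends to 0.\<close>

lemma DERIV_max_0_power:
  "((\<lambda>x. max 0 x ^ Suc (Suc k)) has_real_derivative real (Suc (Suc k)) * max 0 x ^ Suc k) (at x)"
proof (cases x "0::real" rule: linorder_cases)
  case less
  have "((\<lambda>x::real. 0::real) has_real_derivative 0) (at x)" by simp
  from has_field_derivative_transform_within_open[OF this, of "{..<0}"] less
  show ?thesis by (auto simp: max_def)
next
  case greater
  have "((\<lambda>x::real. x ^ Suc (Suc k)) has_real_derivative real (Suc (Suc k)) * x ^ Suc k) (at x)"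
    by (rule derivative_eq_intros refl | simp)+
  from has_field_derivative_transform_within_open[OF this, of "{0<..}"] greater
  show ?thesis by (auto simp: max_def)
next
  case equal
  have "((\<lambda>h::real. max 0 h ^ Suc k) \<longlongrightarrow> max 0 0 ^ Suc k) (at 0)"
    by (intro tendsto_intros)
  then have "((\<lambda>h::real. max 0 h ^ Suc (Suc k) / h) \<longlongrightarrow> 0) (at 0)"
    by (rule tendsto_eq_rhs[OF Lim_transform_eventually])
      (auto simp: eventually_at max_def intro!: exI[of _ 1])
  then show ?thesis by (simp add: equal DERIV_def)
qed

lemma DERIV_max_0_power':
  assumes "(g has_real_derivative d) (at x)" "n = Suc (Suc k)"
  shows "((\<lambda>x. max 0 (g x) ^ n) has_real_derivative real n * max 0 (g x) ^ Suc k * d) (at x)"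
  using DERIV_chain2[OF DERIV_max_0_power[of k "g x"] assms(1)] assms(2) by simp

lemma DERIV_smoothstep: "(smoothstep has_real_derivative smoothstep1 t) (at t)"
proof -
  have *: "(smoothstep has_real_derivative
      (140 * max 0 t ^ 3 - 420 * max 0 t ^ 4 + 420 * max 0 t ^ 5 - 140 * max 0 t ^ 6
       + 140 * max 0 (t-1) ^ 3 + 420 * max 0 (t-1) ^ 4 + 420 * max 0 (t-1) ^ 5 + 140 * max 0 (t-1) ^ 6)) (at t)"
    unfolding smoothstep_def[abs_def]
    by (rule derivative_eq_intros refl DERIV_max_0_power' | simp add: eval_nat_numeral)+
  have "140 * max 0 t ^ 3 - 420 * max 0 t ^ 4 + 420 * max 0 t ^ 5 - 140 * max 0 t ^ 6
       + 140 * max 0 (t-1) ^ 3 + 420 * max 0 (t-1) ^ 4 + 420 * max 0 (t-1) ^ 5 + 140 * max 0 (t-1) ^ 6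
     = smoothstep1 t"
  proof -
    consider "t \<le> 0" | "0 \<le> t" "t \<le> 1" | "1 \<le> t" by linarith
    then show ?thesis
    proof cases
      case 1
      then have "t * (1 - t) \<le> 0" by (simp add: mult_nonpos_nonneg)
      then show ?thesis using 1 by (simp add: smoothstep1_def max_absorb1)
    next
      case 2
      then show ?thesis by (simp add: smoothstep1_def max_absorb1 max_absorb2) algebra
    next
      case 3
      then have "t * (1 - t) \<le> 0" by (simp add: mult_nonneg_nonpos)
      then show ?thesis using 3 by (simp add: smoothstep1_def max_absorb1 max_absorb2) algebra
    qed
  qed
  with * show ?thesis by simp
qed

lemma DERIV_smoothstep1: "(smoothstep1 has_real_derivative smoothstep2 t) (at t)"
  unfolding smoothstep1_def[abs_def]
  by (rule derivative_eq_intros refl DERIV_max_0_power' | simp add: eval_nat_numeral smoothstep2_def)+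

lemma DERIV_smoothstep2: "(smoothstep2 has_real_derivative smoothstep3 t) (at t)"
  unfolding smoothstep2_def[abs_def]
  by (rule derivative_eq_intros refl DERIV_max_0_power' | simp add: eval_nat_numeral smoothstep3_def algebra_simps)+

lemmas DERIV_smoothsteps [derivative_intros] =
  DERIV_smoothstep[THEN DERIV_chain2] DERIV_smoothstep1[THEN DERIV_chain2] DERIV_smoothstep2[THEN DERIV_chain2]

lemma continuous_on_smoothstep:
  "continuous_on UNIV smoothstep" "continuous_on UNIV smoothstep1"
  "continuous_on UNIV smoothstep2" "continuous_on UNIV smoothstep3"
  unfolding smoothstep_def[abs_def] smoothstep1_def[abs_def] smoothstep2_def[abs_def] smoothstep3_def[abs_def]
  by (intro continuous_intros)+

lemmas continuous_on_smoothstep' [continuous_intros] =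
  continuous_on_smoothstep[THEN continuous_on_compose2, OF _ subset_UNIV]

lemma smoothstep_eq_0: "t \<le> 0 \<Longrightarrow> smoothstep t = 0"
  by (simp add: smoothstep_def max_absorb1)

lemma smoothstep_eq_1: "1 \<le> t \<Longrightarrow> smoothstep t = 1"
  by (simp add: smoothstep_def max_absorb2) algebra

lemma smoothstep_deriv_eq_0:
  assumes "t \<le> 0 \<or> 1 \<le> t"
  shows "smoothstep1 t = 0" "smoothstep2 t = 0" "smoothstep3 t = 0"
proof -
  have "t * (1 - t) \<le> 0" using assms by (auto simp: mult_le_0_iff)
  then show "smoothstep1 t = 0" "smoothstep2 t = 0" "smoothstep3 t = 0"
    by (simp_all add: smoothstep1_def smoothstep2_def smoothstep3_def max_absorb1)
qed

lemma smoothstep1_nonneg: "0 \<le> smoothstep1 t"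
  by (simp add: smoothstep1_def)

lemma smoothstep_mono: "s \<le> t \<Longrightarrow> smoothstep s \<le> smoothstep t"
  using DERIV_smoothstep smoothstep1_nonneg by (blast intro: DERIV_nonneg_imp_nondecreasing)

lemma smoothstep_range: "0 \<le> smoothstep t" "smoothstep t \<le> 1"
  using smoothstep_mono[of "min 0 t" t] smoothstep_mono[of t "max 1 t"]
    smoothstep_eq_0[of "min 0 t"] smoothstep_eq_1[of "max 1 t"] by auto

text \<open>With w = t (1 - t) in [0, 1/4] and |1 - 2 t| at most 1, the values are bounded by
  140/64, 420/16 and 840/4 + 840/16.\<close>

lemma smoothstep_deriv_bounds:
  "\<bar>smoothstep1 t\<bar> \<le> 3" "\<bar>smoothstep2 t\<bar> \<le> 27" "\<bar>smoothstep3 t\<bar> \<le> 300"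
proof -
  have "\<bar>smoothstep1 t\<bar> \<le> 3 \<and> \<bar>smoothstep2 t\<bar> \<le> 27 \<and> \<bar>smoothstep3 t\<bar> \<le> 300"
  proof (cases "0 \<le> t \<and> t \<le> 1")
    case False
    then show ?thesis by (auto simp: smoothstep_deriv_eq_0)
  next
    case True
    define w where "w = t * (1 - t)"
    have "0 \<le> (t - 1/2)\<^sup>2" by simp
    then have w: "0 \<le> w" "w \<le> 1/4"
      using True by (simp add: w_def, simp add: w_def power2_eq_square algebra_simps)
    have w2: "0 \<le> w\<^sup>2" "w\<^sup>2 \<le> 1/16" using power_mono[OF w(2,1), of 2] by (simp_all add: power2_eq_square)
    have w3: "0 \<le> w ^ 3" "w ^ 3 \<le> 1/64" using power_mono[OF w(2,1), of 3] w(1) by (simp_all add: eval_nat_numeral)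
    have v: "\<bar>1 - 2 * t\<bar> \<le> 1" using True by auto
    have v2: "(1 - 2 * t)\<^sup>2 \<le> 1" using v by (simp add: abs_square_le_1)
    have "\<bar>420 * w\<^sup>2 * (1 - 2 * t)\<bar> \<le> 27"
      using mult_mono[OF w2(2) v] w2(1) by (simp add: abs_mult)
    moreover have "0 \<le> w * (1 - 2 * t)\<^sup>2" "w * (1 - 2 * t)\<^sup>2 \<le> 1/4"
      using mult_mono[OF w(2) v2] w(1) by simp_all
    then have "\<bar>840 * w * (1 - 2 * t)\<^sup>2 - 840 * w\<^sup>2\<bar> \<le> 300"
      using w2 unfolding mult.assoc by linarith
    ultimately show ?thesis
      using w w3 by (simp add: smoothstep1_def smoothstep2_def smoothstep3_def max_absorb2 flip: w_def)
  qed
  then show "\<bar>smoothstep1 t\<bar> \<le> 3" "\<bar>smoothstep2 t\<bar> \<le> 27" "\<bar>smoothstep3 t\<bar> \<le> 300" by auto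
qed

section \<open>Functions given by uniformly bounded local formulas\<close>

text \<open>Smoothness is required everywhere but bounds only on \<open>U\<close>: a stage formula
  makes sense for all times, while its estimates are proved on its own time interval. The explicit
  bound \<open>M\<close> allows one constant for all stages.\<close>

definition has_partials_on ::
  "(real^3) set \<Rightarrow> (real^3 \<Rightarrow> real) \<Rightarrow> (3 \<Rightarrow> real^3 \<Rightarrow> real) \<Rightarrow> real \<Rightarrow> bool" where
  "has_partials_on U h d M \<longleftrightarrow>
     continuous_on UNIV h \<and> (\<forall>p\<in>U. \<bar>h p\<bar> \<le> M) \<and>
     (\<forall>l. continuous_on UNIV (d l) \<and> (\<forall>p\<in>U. \<bar>d l p\<bar> \<le> M) \<and>
       (\<forall>p. ((\<lambda>s. h (p + s *\<^sub>R axis l 1)) has_real_derivative d l p) (at 0)))"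

lemma has_partials_on_add:
  assumes "has_partials_on U h d M" "has_partials_on U h' d' M'"
  shows "has_partials_on U (\<lambda>p. h p + h' p) (\<lambda>l p. d l p + d' l p) (M + M')"
  using assms unfolding has_partials_on_def
  by (auto intro!: continuous_intros derivative_intros intro: order_trans[OF abs_triangle_ineq add_mono])

lemma eventually_at_0_axis:
  fixes p :: "real^3"
  assumes "open U" "p \<in> U"
  shows "\<forall>\<^sub>F s in nhds 0. p + s *\<^sub>R axis l 1 \<in> U"
proof -
  have "isCont (\<lambda>s::real. p + s *\<^sub>R axis l 1) 0" by (intro continuous_intros)
  then have "((\<lambda>s::real. p + s *\<^sub>R axis l 1) \<longlongrightarrow> p) (nhds 0)"
    by (simp add: isCont_def tendsto_nhds_iff)
  from topological_tendstoD[OF this assms] show ?thesis .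
qed

text \<open>Since the covering sets are open, partial derivatives can be computed from the local
  formulas; the common \<open>M\<close> makes the bounds uniform. The first conclusion gives local
  formulas for \<open>pd l H\<close>, so that the lemma can be applied again to obtain second
  derivatives.\<close>

lemma uniformly_C1_on_local:
  fixes h :: "nat \<Rightarrow> real^3 \<Rightarrow> real"
  assumes U: "\<And>k. open (U k)" "S \<subseteq> (\<Union>k. U k)"
    and H: "\<And>k p. p \<in> U k \<Longrightarrow> H p = h k p"
    and h: "\<And>k. has_partials_on (U k) (h k) (d k) M"
  shows "\<And>k p l. p \<in> U k \<Longrightarrow> pd l H p = d k l p" "uniformly_C1_on S H"
proof -
  have D: "((\<lambda>s. H (p + s *\<^sub>R axis l 1)) has_real_derivative d k l p) (at 0)" if "p \<in> U k" for k p l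
  proof -
    have "\<forall>\<^sub>F s in nhds 0. H (p + s *\<^sub>R axis l 1) = h k (p + s *\<^sub>R axis l 1)"
      by (rule eventually_mono[OF eventually_at_0_axis[OF U(1) that] H])
    moreover have "((\<lambda>s. h k (p + s *\<^sub>R axis l 1)) has_real_derivative d k l p) (at 0)"
      using h[of k] by (auto simp: has_partials_on_def)
    ultimately show ?thesis by (subst DERIV_cong_ev[OF refl _ refl])
  qed
  show pd: "pd l H p = d k l p" if "p \<in> U k" for k p l
    unfolding pd_def by (rule DERIV_imp_deriv[OF D[OF that]])
  have cont: "continuous_on S F" if "\<And>k p. p \<in> U k \<Longrightarrow> F p = f k p" "\<And>k. continuous_on UNIV (f k)"
    for F :: "real^3 \<Rightarrow> real" and f
  proof (rule continuous_on_subset[OF continuous_on_open_UN U(2)])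
    fix k
    have "continuous_on (U k) F = continuous_on (U k) (f k)"
      by (rule continuous_on_cong) (simp_all add: that(1))
    then show "continuous_on (U k) F"
      using continuous_on_subset[OF that(2) subset_UNIV] by blast
  qed (use U in auto)
  have bd: "bounded (F ` S)" if "\<And>k p. p \<in> U k \<Longrightarrow> F p = f k p" "\<And>k p. p \<in> U k \<Longrightarrow> \<bar>f k p\<bar> \<le> M"
    for F :: "real^3 \<Rightarrow> real" and f
  proof (unfold bounded_iff, intro exI ballI, elim imageE)
    fix x p assume "x = F p" "p \<in> S"
    then show "norm x \<le> M" using U(2) that by (metis UN_E real_norm_def subsetD)
  qed
  show "uniformly_C1_on S H"
    unfolding uniformly_C1_on_def
  proof (intro conjI allI ballI)
    show "continuous_on S H" using H h by (intro cont[of H h]) (auto simp: has_partials_on_def)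
    show "bounded (H ` S)" using H h by (intro bd[of H h]) (auto simp: has_partials_on_def)
    fix l
    show "continuous_on S (pd l H)"
      using pd h by (intro cont[of _ "\<lambda>k. d k l"]) (auto simp: has_partials_on_def)
    show "bounded (pd l H ` S)"
      using pd h by (intro bd[of _ "\<lambda>k. d k l"]) (auto simp: has_partials_on_def)
    fix p assume "p \<in> S"
    then obtain k where "p \<in> U k" using U(2) by auto
    then show "(\<lambda>s. H (p + s *\<^sub>R axis l 1)) differentiable (at 0)"
      using D real_differentiable_def by blast
  qed
qed

text \<open>With phases instead of separate sines and cosines, this class is closed under partial derivatives.\<close>
definition trigprod ::
    "real \<Rightarrow> (real \<Rightarrow> real) \<Rightarrow> real \<Rightarrow> real \<Rightarrow> real \<Rightarrow> real \<Rightarrow> real^3 \<Rightarrow> real" where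
  "trigprod c T \<alpha> \<phi> \<beta> \<psi> p = T (p $ 3 - c) * cos (\<alpha> * p $ 1 + \<phi>) * cos (\<beta> * p $ 2 + \<psi>)"

text \<open>As - sin z = cos (z + pi/2), a derivative in x or y is a frequency factor together with
  a phase shift.\<close>

definition trigprod_pd ::
    "real \<Rightarrow> (real \<Rightarrow> real) \<Rightarrow> (real \<Rightarrow> real) \<Rightarrow> real \<Rightarrow> real \<Rightarrow> real \<Rightarrow> real \<Rightarrow> 3 \<Rightarrow> real^3 \<Rightarrow> real" where
  "trigprod_pd c T T' \<alpha> \<phi> \<beta> \<psi> l =
     (if l = 1 then trigprod c (\<lambda>t. \<alpha> * T t) \<alpha> (\<phi> + pi/2) \<beta> \<psi>
      else if l = 2 then trigprod c (\<lambda>t. \<beta> * T t) \<alpha> \<phi> \<beta> (\<psi> + pi/2)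
      else trigprod c T' \<alpha> \<phi> \<beta> \<psi>)"

lemma continuous_on_trigprod [continuous_intros]:
  assumes "continuous_on UNIV T"
  shows "continuous_on S (trigprod c T \<alpha> \<phi> \<beta> \<psi>)"
  unfolding trigprod_def[abs_def]
  by (intro continuous_intros continuous_on_compose2[OF assms]) auto

lemma abs_trigprod_le:
  assumes "\<bar>T (p $ 3 - c)\<bar> \<le> M"
  shows "\<bar>trigprod c T \<alpha> \<phi> \<beta> \<psi> p\<bar> \<le> M"
proof -
  have "\<bar>trigprod c T \<alpha> \<phi> \<beta> \<psi> p\<bar> \<le> \<bar>T (p $ 3 - c)\<bar> * 1 * 1"
    unfolding trigprod_def abs_mult by (intro mult_mono) auto
  with assms show ?thesis by simp
qed

lemma has_partials_on_trigprod:
  assumes T: "\<And>t. (T has_real_derivative T' t) (at t)" "continuous_on UNIV T'"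
    and b: "\<And>t. t \<in> I \<Longrightarrow> \<bar>T t\<bar> \<le> M \<and> \<bar>\<alpha> * T t\<bar> \<le> M \<and> \<bar>\<beta> * T t\<bar> \<le> M \<and> \<bar>T' t\<bar> \<le> M"
    and U: "\<And>p. p \<in> U \<Longrightarrow> p $ 3 - c \<in> I"
  shows "has_partials_on U (trigprod c T \<alpha> \<phi> \<beta> \<psi>) (trigprod_pd c T T' \<alpha> \<phi> \<beta> \<psi>) M"
  unfolding has_partials_on_def
proof (intro conjI allI ballI)
  have cT: "continuous_on UNIV T"
    using T(1) by (meson DERIV_continuous continuous_at_imp_continuous_on)
  then show "continuous_on UNIV (trigprod c T \<alpha> \<phi> \<beta> \<psi>)" by (intro continuous_intros)
  show "\<bar>trigprod c T \<alpha> \<phi> \<beta> \<psi> p\<bar> \<le> M" if "p \<in> U" for p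
    using b[OF U[OF that]] by (intro abs_trigprod_le) auto
  fix l :: 3
  show "continuous_on UNIV (trigprod_pd c T T' \<alpha> \<phi> \<beta> \<psi> l)"
    using cT T(2) by (auto simp: trigprod_pd_def intro!: continuous_intros)
  show "\<bar>trigprod_pd c T T' \<alpha> \<phi> \<beta> \<psi> l p\<bar> \<le> M" if "p \<in> U" for p
    using b[OF U[OF that]] by (auto simp: trigprod_pd_def intro!: abs_trigprod_le)
  fix p :: "real^3"
  have T1: "((\<lambda>s. T (p $ 3 + s - c)) has_real_derivative T' (p $ 3 - c)) (at 0)"
  proof -
    have "((\<lambda>s. p $ 3 + s - c) has_real_derivative 1) (at 0)"
      by (rule derivative_eq_intros refl | simp)+
    from DERIV_chain2[OF _ this, of T] T(1) show ?thesis by simp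
  qed
  have "l = 1 \<or> l = 2 \<or> l = 3" using exhaust_3 by blast
  then show "((\<lambda>s. trigprod c T \<alpha> \<phi> \<beta> \<psi> (p + s *\<^sub>R axis l 1)) has_real_derivative
      trigprod_pd c T T' \<alpha> \<phi> \<beta> \<psi> l p) (at 0)"
  proof (elim disjE)
    assume l: "l = 1"
    show ?thesis unfolding l trigprod_pd_def trigprod_def
      by (rule derivative_eq_intros refl | simp add: axis_def add.assoc[symmetric] cos_add[of _ "pi/2"])+
  next
    assume l: "l = 2"
    show ?thesis unfolding l trigprod_pd_def trigprod_def
      by (rule derivative_eq_intros refl | simp add: axis_def add.assoc[symmetric] cos_add[of _ "pi/2"])+
  next
    assume l: "l = 3"
    have "((\<lambda>s. T (p $ 3 + s - c) * cos (\<alpha> * p $ 1 + \<phi>) * cos (\<beta> * p $ 2 + \<psi>)) has_real_derivative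
      T' (p $ 3 - c) * cos (\<alpha> * p $ 1 + \<phi>) * cos (\<beta> * p $ 2 + \<psi>)) (at 0)"
      by (rule derivative_eq_intros T1 refl | simp)+
    then show ?thesis unfolding l trigprod_pd_def trigprod_def by (simp add: axis_def)
  qed
qed

text \<open>Each derivative in x or y costs a factor of at most \<gamma>, which the weights in
  \<open>b\<close> compensate. As \<gamma> is at least 1, the weighted bounds also cover the lower
  orders.\<close>

lemma has_partials_on_trigprod_pd:
  assumes T: "\<And>t. (T has_real_derivative T' t) (at t)" "\<And>t. (T' has_real_derivative T'' t) (at t)"
      "continuous_on UNIV T''"
    and \<gamma>: "1 \<le> \<gamma>" "\<bar>\<alpha>\<bar> \<le> \<gamma>" "\<bar>\<beta>\<bar> \<le> \<gamma>"
    and b: "\<And>t. t \<in> I \<Longrightarrow> \<gamma>\<^sup>2 * \<bar>T t\<bar> \<le> M \<and> \<gamma> * \<bar>T' t\<bar> \<le> M \<and> \<bar>T'' t\<bar> \<le> M"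
    and U: "\<And>p. p \<in> U \<Longrightarrow> p $ 3 - c \<in> I"
  shows "has_partials_on U (trigprod c T \<alpha> \<phi> \<beta> \<psi>) (trigprod_pd c T T' \<alpha> \<phi> \<beta> \<psi>) M"
    and "\<exists>d. has_partials_on U (trigprod_pd c T T' \<alpha> \<phi> \<beta> \<psi> l) d M"
proof -
  have cT': "continuous_on UNIV T'"
    using T(2) by (meson DERIV_continuous continuous_at_imp_continuous_on)
  have lower: "\<bar>x\<bar> \<le> M" "\<bar>\<alpha> * x\<bar> \<le> M" "\<bar>\<beta> * x\<bar> \<le> M" if "\<gamma> * \<bar>x\<bar> \<le> M" for x
    using mult_right_mono[OF \<gamma>(1), of "\<bar>x\<bar>"] mult_right_mono[OF \<gamma>(2), of "\<bar>x\<bar>"]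
      mult_right_mono[OF \<gamma>(3), of "\<bar>x\<bar>"] that by (simp_all add: abs_mult)
  have up: "\<gamma> * \<bar>x\<bar> \<le> M \<and> \<gamma> * \<bar>\<alpha> * x\<bar> \<le> M \<and> \<gamma> * \<bar>\<beta> * x\<bar> \<le> M" if "\<gamma>\<^sup>2 * \<bar>x\<bar> \<le> M" for x
  proof -
    have "r * (\<gamma> * \<bar>x\<bar>) \<le> M" if "r \<le> \<gamma>" for r
    proof -
      have "r * (\<gamma> * \<bar>x\<bar>) \<le> \<gamma> * (\<gamma> * \<bar>x\<bar>)" using that \<gamma>(1) by (intro mult_right_mono) auto
      then show ?thesis using \<open>\<gamma>\<^sup>2 * \<bar>x\<bar> \<le> M\<close> by (simp add: power2_eq_square mult.assoc)
    qed
    from this[OF \<gamma>(1)] this[OF \<gamma>(2)] this[OF \<gamma>(3)] show ?thesis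
      by (simp add: abs_mult mult.left_commute[of \<gamma>])
  qed
  show "has_partials_on U (trigprod c T \<alpha> \<phi> \<beta> \<psi>) (trigprod_pd c T T' \<alpha> \<phi> \<beta> \<psi>) M"
    using b up lower by (intro has_partials_on_trigprod[OF T(1) cT' _ U]) blast+
  have 1: "has_partials_on U (trigprod c (\<lambda>t. a * T t) \<alpha> \<phi>' \<beta> \<psi>')
      (trigprod_pd c (\<lambda>t. a * T t) (\<lambda>t. a * T' t) \<alpha> \<phi>' \<beta> \<psi>') M" if a: "a = \<alpha> \<or> a = \<beta>" for a \<phi>' \<psi>'
  proof (rule has_partials_on_trigprod[OF DERIV_cmult[OF T(1)] _ _ U])
    show "continuous_on UNIV (\<lambda>t. a * T' t)" by (intro continuous_intros cT')
    fix t assume "t \<in> I"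
    with b have "\<gamma>\<^sup>2 * \<bar>T t\<bar> \<le> M" "\<gamma> * \<bar>T' t\<bar> \<le> M" by blast+
    with a show "\<bar>a * T t\<bar> \<le> M \<and> \<bar>\<alpha> * (a * T t)\<bar> \<le> M \<and> \<bar>\<beta> * (a * T t)\<bar> \<le> M \<and> \<bar>a * T' t\<bar> \<le> M"
      using up lower by blast
  qed
  have 2: "has_partials_on U (trigprod c T' \<alpha> \<phi> \<beta> \<psi>) (trigprod_pd c T' T'' \<alpha> \<phi> \<beta> \<psi>) M"
    using b lower by (intro has_partials_on_trigprod[OF T(2,3) _ U]) blast
  show "\<exists>d. has_partials_on U (trigprod_pd c T T' \<alpha> \<phi> \<beta> \<psi> l) d M"
    unfolding trigprod_pd_def using 1 2 by auto
qed

section \<open>One stage: exchanging a mode of frequency n for one of frequency 2n\<close>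

text \<open>On the time interval (0, 6) of a stage, the new mode is switched on during [1, 2], the decay
  rate of the old mode is raised during [2, 3], and the old mode is switched off during [3, 4]. The
  constants in the exponents make the ratio new/old equal to exp (- n * t) during [1, 2] and the
  ratio old/new equal to exp (- n * (5 - t)) during [3, 4].\<close>
definition rate :: "real \<Rightarrow> real" where
  "rate t = 1 + 5 * smoothstep1 (t - 2)"

definition dying :: "real \<Rightarrow> real \<Rightarrow> real" where
  "dying n t = (1 - smoothstep (t - 3)) * exp (- n * (10 + t + 5 * smoothstep (t - 2)))"

definition dying1 :: "real \<Rightarrow> real \<Rightarrow> real" where
  "dying1 n t = - (smoothstep1 (t - 3) + (1 - smoothstep (t - 3)) * n * rate t)
     * exp (- n * (10 + t + 5 * smoothstep (t - 2)))"

definition born :: "real \<Rightarrow> real \<Rightarrow> real" where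
  "born n t = smoothstep (t - 1) * exp (- 2 * n * (5 + t))"

definition born1 :: "real \<Rightarrow> real \<Rightarrow> real" where
  "born1 n t = (smoothstep1 (t - 1) - 2 * n * smoothstep (t - 1)) * exp (- 2 * n * (5 + t))"

text \<open>The coefficient for which exp (- n * p t) with p' = rate solves f'' = n^2 * coefficient * f.\<close>
definition dying_coeff :: "real \<Rightarrow> real \<Rightarrow> real" where
  "dying_coeff n t = (rate t)\<^sup>2 - 5 * smoothstep2 (t - 2) / n"

definition dying_coeff1 :: "real \<Rightarrow> real \<Rightarrow> real" where
  "dying_coeff1 n t = 10 * rate t * smoothstep2 (t - 2) - 5 * smoothstep3 (t - 2) / n"

text \<open>The errors made by switching on or off, divided by n^2 times the amplitude of the mode that
  dominates at that time.\<close>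
definition birth_coupling :: "real \<Rightarrow> real \<Rightarrow> real" where
  "birth_coupling n t = (smoothstep2 (t - 1) - 4 * n * smoothstep1 (t - 1)) / n\<^sup>2 * exp (- n * t)"

definition birth_coupling1 :: "real \<Rightarrow> real \<Rightarrow> real" where
  "birth_coupling1 n t = ((smoothstep3 (t - 1) - 4 * n * smoothstep2 (t - 1))
     - n * (smoothstep2 (t - 1) - 4 * n * smoothstep1 (t - 1))) / n\<^sup>2 * exp (- n * t)"

definition death_coupling :: "real \<Rightarrow> real \<Rightarrow> real" where
  "death_coupling n t = (2 * n * smoothstep1 (t - 3) - smoothstep2 (t - 3)) / n\<^sup>2 * exp (- n * (5 - t))"

definition death_coupling1 :: "real \<Rightarrow> real \<Rightarrow> real" where
  "death_coupling1 n t = ((2 * n * smoothstep2 (t - 3) - smoothstep3 (t - 3))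
     + n * (2 * n * smoothstep1 (t - 3) - smoothstep2 (t - 3))) / n\<^sup>2 * exp (- n * (5 - t))"

section \<open>The differential equations within one stage\<close>

lemma DERIV_dying: "(dying n has_real_derivative dying1 n t) (at t)"
  unfolding dying_def[abs_def]
  by (rule derivative_eq_intros refl | simp add: dying1_def rate_def algebra_simps)+

text \<open>The terms containing derivatives of the cutoff live on [3, 4]. There \<open>rate\<close>
  is 1 and the new mode is fully switched on, a pure exponential, so these terms can be written as a
  multiple of \<open>born\<close>.\<close>

lemma DERIV_dying1:
  assumes "0 < n"
  shows "(dying1 n has_real_derivative n\<^sup>2 * (dying_coeff n t * dying n t + death_coupling n t * born n t)) (at t)"
proof -
  define e where "e = exp (- n * (10 + t + 5 * smoothstep (t - 2)))"
  have D: "(dying1 n has_real_derivative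
     (- smoothstep2 (t - 3) + 2 * n * rate t * smoothstep1 (t - 3)
       + (1 - smoothstep (t - 3)) * n\<^sup>2 * dying_coeff n t) * e) (at t)"
    unfolding dying1_def[abs_def] rate_def e_def
    by (rule derivative_eq_intros refl
        | use assms in \<open>simp add: dying_coeff_def rate_def field_simps power2_eq_square\<close>)+
  have "n\<^sup>2 * death_coupling n t * born n t = (2 * n * rate t * smoothstep1 (t - 3) - smoothstep2 (t - 3)) * e"
  proof (cases "3 \<le> t \<and> t \<le> 4")
    case True
    then have "smoothstep1 (t - 2) = 0" "smoothstep (t - 2) = 1" "smoothstep (t - 1) = 1"
      by (auto simp: smoothstep_deriv_eq_0 smoothstep_eq_1)
    moreover have "exp (- n * (5 - t)) * exp (- 2 * n * (5 + t)) = exp (- n * (15 + t))"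
      by (simp flip: exp_add add: algebra_simps)
    ultimately show ?thesis
      using assms by (simp add: death_coupling_def born_def e_def rate_def)
  next
    case False
    then show ?thesis by (auto simp: death_coupling_def smoothstep_deriv_eq_0)
  qed
  then have "(- smoothstep2 (t - 3) + 2 * n * rate t * smoothstep1 (t - 3)
       + (1 - smoothstep (t - 3)) * n\<^sup>2 * dying_coeff n t) * e
     = n\<^sup>2 * (dying_coeff n t * dying n t + death_coupling n t * born n t)"
    unfolding dying_def e_def[symmetric] by (simp add: algebra_simps)
  with D show ?thesis by simp
qed

lemma DERIV_born: "(born n has_real_derivative born1 n t) (at t)"
  unfolding born_def[abs_def]
  by (rule derivative_eq_intros refl | simp add: born1_def algebra_simps)+

text \<open>Here the cutoff terms live on [1, 2], where the old mode is still the pure exponential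
  exp (- n (10 + t)) and can carry them. The factor 4 is the squared frequency ratio, so the new
  mode has diagonal coefficient 1.\<close>

lemma DERIV_born1:
  assumes "0 < n"
  shows "(born1 n has_real_derivative n\<^sup>2 * (4 * born n t + birth_coupling n t * dying n t)) (at t)"
proof -
  define e where "e = exp (- 2 * n * (5 + t))"
  have D: "(born1 n has_real_derivative
     (smoothstep2 (t - 1) - 4 * n * smoothstep1 (t - 1) + 4 * n\<^sup>2 * smoothstep (t - 1)) * e) (at t)"
    unfolding born1_def[abs_def] e_def
    by (rule derivative_eq_intros refl | simp add: algebra_simps power2_eq_square)+
  have "n\<^sup>2 * birth_coupling n t * dying n t = (smoothstep2 (t - 1) - 4 * n * smoothstep1 (t - 1)) * e"
  proof (cases "1 \<le> t \<and> t \<le> 2")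
    case True
    then have "smoothstep (t - 2) = 0" "smoothstep (t - 3) = 0"
      by (auto simp: smoothstep_eq_0)
    moreover have "exp (- n * t) * exp (- n * (10 + t)) = e"
      by (simp flip: exp_add add: algebra_simps e_def)
    ultimately show ?thesis
      using assms by (simp add: birth_coupling_def dying_def)
  next
    case False
    then show ?thesis by (auto simp: birth_coupling_def smoothstep_deriv_eq_0)
  qed
  then have "(smoothstep2 (t - 1) - 4 * n * smoothstep1 (t - 1) + 4 * n\<^sup>2 * smoothstep (t - 1)) * e
     = n\<^sup>2 * (4 * born n t + birth_coupling n t * dying n t)"
    unfolding born_def e_def[symmetric] by (simp add: algebra_simps)
  with D show ?thesis by simp
qed

lemma DERIV_dying_coeff: "0 < n \<Longrightarrow> (dying_coeff n has_real_derivative dying_coeff1 n t) (at t)"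
  unfolding dying_coeff_def[abs_def] rate_def
  by (rule derivative_eq_intros refl | simp add: dying_coeff1_def rate_def algebra_simps)+

lemma DERIV_birth_coupling: "0 < n \<Longrightarrow> (birth_coupling n has_real_derivative birth_coupling1 n t) (at t)"
  unfolding birth_coupling_def[abs_def] 
  by (rule derivative_eq_intros refl | simp add: birth_coupling1_def field_simps power2_eq_square)+

lemma DERIV_death_coupling: "0 < n \<Longrightarrow> (death_coupling n has_real_derivative death_coupling1 n t) (at t)"
  unfolding death_coupling_def[abs_def] 
  by (rule derivative_eq_intros refl | simp add: death_coupling1_def field_simps power2_eq_square)+

lemma continuous_on_stage [continuous_intros]:
  "continuous_on UNIV (dying n)" "continuous_on UNIV (born n)"
  "continuous_on UNIV (dying_coeff n)" "continuous_on UNIV (dying_coeff1 n)"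
  "continuous_on UNIV (birth_coupling n)" "continuous_on UNIV (birth_coupling1 n)"
  "continuous_on UNIV (death_coupling n)" "continuous_on UNIV (death_coupling1 n)"
  unfolding dying_def[abs_def] born_def[abs_def] dying_coeff_def[abs_def] dying_coeff1_def[abs_def] birth_coupling_def[abs_def]
    birth_coupling1_def[abs_def] death_coupling_def[abs_def] death_coupling1_def[abs_def] rate_def divide_inverse
  by (intro continuous_intros)+

lemma dying_eq_0: "4 \<le> t \<Longrightarrow> dying n t = 0"
  by (simp add: dying_def smoothstep_eq_1)

lemma born_eq_0: "t \<le> 1 \<Longrightarrow> born n t = 0"
  by (simp add: born_def smoothstep_eq_0)

text \<open>This is the handover to the next stage. The offsets fit because 10 + (t - 5) = 5 +
  t.\<close>

lemma born_eq_dying: "5 \<le> t \<Longrightarrow> t \<le> 6 \<Longrightarrow> born n t = dying (2 * n) (t - 5)"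
  by (simp add: born_def dying_def smoothstep_eq_0 smoothstep_eq_1)

text \<open>All perturbations are built from derivatives of steps, whose transitions take place
  within [1, 2], [2, 3] and [3, 4].\<close>

lemma coefficients_trivial:
  assumes "t \<le> 1 \<or> 4 \<le> t"
  shows "dying_coeff n t = 1" "birth_coupling n t = 0" "death_coupling n t = 0"
  using assms by (auto simp: dying_coeff_def rate_def birth_coupling_def death_coupling_def smoothstep_deriv_eq_0)

section \<open>Bounds within one stage, uniform in the frequency\<close>

lemma rate_bounds: "1 \<le> rate t" "rate t \<le> 16"
  using smoothstep1_nonneg[of "t - 2"] smoothstep_deriv_bounds(1)[of "t - 2"] by (auto simp: rate_def)

text \<open>The correction by the second derivative of the step is at most 27/200 for
  \<open>n\<close> at least 1000, so the coefficient stays well above 0.\<close>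

lemma dying_coeff_bounds:
  assumes "1000 \<le> n"
  shows "4/5 \<le> dying_coeff n t" "dying_coeff n t \<le> 300" "\<bar>dying_coeff1 n t\<bar> \<le> 10000"
proof -
  have r: "1 \<le> (rate t)\<^sup>2" "(rate t)\<^sup>2 \<le> 256"
    using rate_bounds[of t] power_mono[of "rate t" 16 2] by (simp_all add: one_le_power)
  have *: "\<bar>5 * x / n\<bar> \<le> y / 200" if "\<bar>x\<bar> \<le> y" for x y
  proof -
    have "\<bar>x\<bar> / n \<le> y / 1000" using that assms by (intro frac_le) auto
    moreover have "\<bar>5 * x / n\<bar> = 5 * (\<bar>x\<bar> / n)" using assms by (simp add: abs_mult)
    ultimately show ?thesis by linarith
  qed
  note d = *[OF smoothstep_deriv_bounds(2)[of "t - 2"]] *[OF smoothstep_deriv_bounds(3)[of "t - 2"]]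
  have rs: "\<bar>rate t * smoothstep2 (t - 2)\<bar> \<le> 16 * 27"
    unfolding abs_mult using rate_bounds[of t] smoothstep_deriv_bounds(2) by (intro mult_mono) auto
  show "4/5 \<le> dying_coeff n t" "dying_coeff n t \<le> 300"
    using r d(1) unfolding dying_coeff_def by linarith+
  show "\<bar>dying_coeff1 n t\<bar> \<le> 10000"
    using rs d(2) unfolding dying_coeff1_def mult.assoc by linarith
qed

text \<open>The prefactor is already of order 1/n, so it suffices to estimate the exponential by 1.
  The weight \<open>n\<close> is there because the coupling multiplies functions oscillating with
  frequencies \<open>n\<close> and 2 n, whose derivatives must remain bounded. A time derivative
  costs at most another factor of order \<open>n\<close>.\<close>

lemma birth_coupling_bounds:
  assumes n: "1000 \<le> n" and t: "0 \<le> t"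
  shows "n * \<bar>birth_coupling n t\<bar> \<le> 100" "\<bar>birth_coupling1 n t\<bar> \<le> 1000"
proof -
  have e: "exp (- n * t) \<le> 1" using n t by simp
  note s = smoothstep_deriv_bounds[of "t - 1"]
  have ns: "\<bar>n * smoothstep1 (t - 1)\<bar> \<le> n * 3" "\<bar>n * smoothstep2 (t - 1)\<bar> \<le> n * 27"
    unfolding abs_mult using n s by (auto intro!: mult_mono)
  have "\<bar>smoothstep2 (t - 1) - 4 * n * smoothstep1 (t - 1)\<bar> \<le> 100 * n"
    using ns s n unfolding mult.assoc by linarith
  then have *: "\<bar>smoothstep2 (t - 1) - 4 * n * smoothstep1 (t - 1)\<bar> / n\<^sup>2 \<le> 100 / n"
    using n by (simp add: field_simps power2_eq_square)
  have "\<bar>birth_coupling n t\<bar> \<le> 100 / n * 1"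
    unfolding birth_coupling_def abs_mult abs_divide using n e * by (intro mult_mono) auto
  then show "n * \<bar>birth_coupling n t\<bar> \<le> 100" using n by (simp add: field_simps)
  have "\<bar>n * (smoothstep2 (t - 1) - 4 * n * smoothstep1 (t - 1))\<bar> \<le> n * (100 * n)"
    unfolding abs_mult using n \<open>\<bar>smoothstep2 (t - 1) - 4 * n * smoothstep1 (t - 1)\<bar> \<le> 100 * n\<close>
    by (auto intro!: mult_mono)
  moreover have "1000 * n \<le> n * n" using n by (intro mult_right_mono) auto
  ultimately have "\<bar>(smoothstep3 (t - 1) - 4 * n * smoothstep2 (t - 1))
     - n * (smoothstep2 (t - 1) - 4 * n * smoothstep1 (t - 1))\<bar> \<le> 1000 * n\<^sup>2"
    using ns s n unfolding mult.assoc power2_eq_square by linarith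
  then have "\<bar>(smoothstep3 (t - 1) - 4 * n * smoothstep2 (t - 1))
     - n * (smoothstep2 (t - 1) - 4 * n * smoothstep1 (t - 1))\<bar> / n\<^sup>2 \<le> 1000"
    using n by (simp add: divide_simps)
  then have "\<bar>birth_coupling1 n t\<bar> \<le> 1000 * 1"
    unfolding birth_coupling1_def abs_mult abs_divide using n e by (intro mult_mono) auto
  then show "\<bar>birth_coupling1 n t\<bar> \<le> 1000" by simp
qed

lemma death_coupling_bounds:
  assumes n: "1000 \<le> n"
  shows "n * \<bar>death_coupling n t\<bar> \<le> 100" "\<bar>death_coupling1 n t\<bar> \<le> 1000"
proof -
  have "n * \<bar>death_coupling n t\<bar> \<le> 100 \<and> \<bar>death_coupling1 n t\<bar> \<le> 1000"
  \<comment> \<open>The exponential exceeds 1 for t > 5, but the coupling has already vanished from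
    t = 4 on.\<close>
  proof (cases "t \<le> 4")
    case False
    then show ?thesis by (simp add: death_coupling_def death_coupling1_def smoothstep_deriv_eq_0)
  next
    case True
    have e: "exp (- n * (5 - t)) \<le> 1" using n True by simp
    note s = smoothstep_deriv_bounds[of "t - 3"]
    have ns: "\<bar>n * smoothstep1 (t - 3)\<bar> \<le> n * 3" "\<bar>n * smoothstep2 (t - 3)\<bar> \<le> n * 27"
      unfolding abs_mult using n s by (auto intro!: mult_mono)
    have c: "\<bar>2 * n * smoothstep1 (t - 3) - smoothstep2 (t - 3)\<bar> \<le> 100 * n"
      using ns s n unfolding mult.assoc by linarith
    then have *: "\<bar>2 * n * smoothstep1 (t - 3) - smoothstep2 (t - 3)\<bar> / n\<^sup>2 \<le> 100 / n"
      using n by (simp add: field_simps power2_eq_square)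
    have 1: "\<bar>death_coupling n t\<bar> \<le> 100 / n * 1"
      unfolding death_coupling_def abs_mult abs_divide using n e * by (intro mult_mono) auto
    have "\<bar>n * (2 * n * smoothstep1 (t - 3) - smoothstep2 (t - 3))\<bar> \<le> n * (100 * n)"
      unfolding abs_mult using n c by (auto intro!: mult_mono)
    moreover have "1000 * n \<le> n * n" using n by (intro mult_right_mono) auto
    ultimately have "\<bar>(2 * n * smoothstep2 (t - 3) - smoothstep3 (t - 3))
     + n * (2 * n * smoothstep1 (t - 3) - smoothstep2 (t - 3))\<bar> \<le> 1000 * n\<^sup>2"
      using ns s n unfolding mult.assoc power2_eq_square by linarith
    then have "\<bar>(2 * n * smoothstep2 (t - 3) - smoothstep3 (t - 3))
     + n * (2 * n * smoothstep1 (t - 3) - smoothstep2 (t - 3))\<bar> / n\<^sup>2 \<le> 1000"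
      using n by (simp add: divide_simps)
    then have "\<bar>death_coupling1 n t\<bar> \<le> 1000 * 1"
      unfolding death_coupling1_def abs_mult abs_divide using n e by (intro mult_mono) auto
    with 1 show ?thesis using n by (simp add: field_simps)
  qed
  then show "n * \<bar>death_coupling n t\<bar> \<le> 100" "\<bar>death_coupling1 n t\<bar> \<le> 1000" by auto
qed

text \<open>By exp n \<ge> 1 + n + n^2/2. This absorbs the two frequency factors of second
  derivatives.\<close>

lemma sq_exp_minus_le: "n\<^sup>2 * exp (- n) \<le> 2" if "0 \<le> n" for n :: real
  using exp_lower_Taylor_quadratic[OF that] that by (simp add: exp_minus field_simps)

lemma dying_bounds:
  assumes n: "1000 \<le> n" and t: "0 \<le> t"
  shows "\<bar>dying n t\<bar> \<le> exp (- n)" "\<bar>dying1 n t\<bar> \<le> 20 * n * exp (- n)"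
proof -
  have "n * 1 \<le> n * (10 + t + 5 * smoothstep (t - 2))"
    using n t smoothstep_range(1)[of "t - 2"] by (intro mult_left_mono) auto
  then have e: "exp (- n * (10 + t + 5 * smoothstep (t - 2))) \<le> exp (- n)" by simp
  have "\<bar>dying n t\<bar> \<le> 1 * exp (- n)"
    unfolding dying_def abs_mult using e smoothstep_range[of "t - 3"] by (intro mult_mono) auto
  then show "\<bar>dying n t\<bar> \<le> exp (- n)" by simp
  have "\<bar>(1 - smoothstep (t - 3)) * n * rate t\<bar> \<le> 1 * n * 16"
    unfolding abs_mult using n rate_bounds[of t] smoothstep_range[of "t - 3"] by (intro mult_mono) auto
  then have "\<bar>- (smoothstep1 (t - 3) + (1 - smoothstep (t - 3)) * n * rate t)\<bar> \<le> 20 * n"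
    using smoothstep_deriv_bounds(1)[of "t - 3"] n by linarith
  then show "\<bar>dying1 n t\<bar> \<le> 20 * n * exp (- n)"
    unfolding dying1_def abs_mult using e n by (intro mult_mono) auto
qed

lemma born_bounds:
  assumes n: "1000 \<le> n" and t: "0 \<le> t"
  shows "\<bar>born n t\<bar> \<le> exp (- n)" "\<bar>born1 n t\<bar> \<le> 20 * n * exp (- n)"
proof -
  have "n * 1 \<le> n * (2 * (5 + t))"
    using n t by (intro mult_left_mono) auto
  then have e: "exp (- 2 * n * (5 + t)) \<le> exp (- n)" by (simp add: algebra_simps)
  have "\<bar>born n t\<bar> \<le> 1 * exp (- n)"
    unfolding born_def abs_mult using e smoothstep_range[of "t - 1"] by (intro mult_mono) auto
  then show "\<bar>born n t\<bar> \<le> exp (- n)" by simp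
  have "\<bar>n * smoothstep (t - 1)\<bar> \<le> n * 1"
    unfolding abs_mult using n smoothstep_range[of "t - 1"] by (intro mult_mono) auto
  then have "\<bar>smoothstep1 (t - 1) - 2 * n * smoothstep (t - 1)\<bar> \<le> 20 * n"
    using smoothstep_deriv_bounds(1)[of "t - 1"] n unfolding mult.assoc by linarith
  then show "\<bar>born1 n t\<bar> \<le> 20 * n * exp (- n)"
    unfolding born1_def abs_mult using e n by (intro mult_mono) auto
qed

section \<open>Gluing the stages\<close>

text \<open>The Boolean says whether the coordinate in question carries the old mode of the stage. The roles
  of x and y alternate: x carries the old mode in the stages of even index.\<close>
definition amplitude :: "bool \<Rightarrow> real \<Rightarrow> real \<Rightarrow> real" where
  "amplitude b = (if b then dying else born)"

definition amplitude1 :: "bool \<Rightarrow> real \<Rightarrow> real \<Rightarrow> real" where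
  "amplitude1 b = (if b then dying1 else born1)"

definition wave :: "bool \<Rightarrow> real \<Rightarrow> real" where
  "wave b n = (if b then n else 2 * n)"

definition diag :: "bool \<Rightarrow> real \<Rightarrow> real \<Rightarrow> real" where
  "diag b n t = (if b then dying_coeff n t else 1)"

definition diag1 :: "bool \<Rightarrow> real \<Rightarrow> real \<Rightarrow> real" where
  "diag1 b n t = (if b then dying_coeff1 n t else 0)"

definition coupling :: "bool \<Rightarrow> real \<Rightarrow> real \<Rightarrow> real" where
  "coupling b = (if b then birth_coupling else death_coupling)"

definition coupling1 :: "bool \<Rightarrow> real \<Rightarrow> real \<Rightarrow> real" where
  "coupling1 b = (if b then birth_coupling1 else death_coupling1)"

text \<open>The right-hand side of the linear system for the two amplitudes, written symmetrically
  in the old and the new mode; the coupling factor equals n^2.\<close>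

definition amplitude2 :: "bool \<Rightarrow> real \<Rightarrow> real \<Rightarrow> real" where
  "amplitude2 b n t = (wave b n)\<^sup>2 * diag b n t * amplitude b n t
     + wave b n * wave (\<not> b) n / 2 * coupling (\<not> b) n t * amplitude (\<not> b) n t"

lemma DERIV_amplitude: "(amplitude b n has_real_derivative amplitude1 b n t) (at t)"
  by (simp add: amplitude_def amplitude1_def DERIV_dying DERIV_born)

lemma DERIV_amplitude1: "0 < n \<Longrightarrow> (amplitude1 b n has_real_derivative amplitude2 b n t) (at t)"
  using DERIV_dying1[of n t] DERIV_born1[of n t]
  by (simp add: amplitude_def amplitude1_def amplitude2_def wave_def diag_def coupling_def power2_eq_square algebra_simps)

lemma DERIV_diag: "0 < n \<Longrightarrow> (diag b n has_real_derivative diag1 b n t) (at t)"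
  using DERIV_dying_coeff[of n t] unfolding diag_def[abs_def] diag1_def[abs_def] by auto

lemma DERIV_coupling: "0 < n \<Longrightarrow> (coupling b n has_real_derivative coupling1 b n t) (at t)"
  by (simp add: coupling_def coupling1_def DERIV_birth_coupling DERIV_death_coupling)

lemma continuous_on_amplitude_diag_coupling:
  "continuous_on UNIV (amplitude2 b n)" "continuous_on UNIV (diag1 b n)" "continuous_on UNIV (coupling1 b n)"
proof -
  have "continuous_on UNIV (amplitude b n)" "continuous_on UNIV (diag b n)" "continuous_on UNIV (coupling b n)" for b
    unfolding amplitude_def diag_def[abs_def] coupling_def by (cases b; auto intro!: continuous_intros)+
  then show "continuous_on UNIV (amplitude2 b n)"
    unfolding amplitude2_def[abs_def] by (intro continuous_intros)
  show "continuous_on UNIV (diag1 b n)" "continuous_on UNIV (coupling1 b n)"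
    unfolding diag1_def[abs_def] coupling1_def by (cases b; auto intro!: continuous_intros)+
qed

lemma diag_bounds:
  assumes "1000 \<le> n"
  shows "4/5 \<le> diag b n t" "diag b n t \<le> 300" "\<bar>diag1 b n t\<bar> \<le> 10000"
  using dying_coeff_bounds[OF assms, of t] by (auto simp: diag_def diag1_def)

lemma coupling_bounds:
  assumes n: "1000 \<le> n" and t: "0 \<le> t"
  shows "2 * n * \<bar>coupling b n t\<bar> \<le> 200" "\<bar>coupling b n t\<bar> \<le> 1/10" "\<bar>coupling1 b n t\<bar> \<le> 1000"
proof -
  have *: "n * \<bar>coupling b n t\<bar> \<le> 100"
    using birth_coupling_bounds(1)[OF n t] death_coupling_bounds(1)[OF n, of t] by (simp add: coupling_def)
  then show "2 * n * \<bar>coupling b n t\<bar> \<le> 200" by simp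
  have "1000 * \<bar>coupling b n t\<bar> \<le> n * \<bar>coupling b n t\<bar>" using n by (intro mult_right_mono) auto
  with * show "\<bar>coupling b n t\<bar> \<le> 1/10" by linarith
  show "\<bar>coupling1 b n t\<bar> \<le> 1000"
    using birth_coupling_bounds(2)[OF n t] death_coupling_bounds(2)[OF n, of t] by (simp add: coupling1_def)
qed

text \<open>The weights account for up to two derivatives in x or y at frequency at most 2 n. All
  bounds but the first are independent of the stage; the largest contribution to the last one is 4 *
  300 * 2 = 2400 from the diagonal term.\<close>

lemma amplitude_bounds:
  assumes n: "1000 \<le> n" and t: "0 \<le> t"
  shows "\<bar>amplitude b n t\<bar> \<le> exp (- n)" "(2 * n)\<^sup>2 * \<bar>amplitude b n t\<bar> \<le> 3000"
    "2 * n * \<bar>amplitude1 b n t\<bar> \<le> 3000" "\<bar>amplitude2 b n t\<bar> \<le> 3000"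
proof -
  have e: "n\<^sup>2 * exp (- n) \<le> 2" using n by (intro sq_exp_minus_le) auto
  show *: "\<bar>amplitude b n t\<bar> \<le> exp (- n)" for b
    using dying_bounds(1)[OF n t] born_bounds(1)[OF n t] by (simp add: amplitude_def)
  have 2: "n\<^sup>2 * \<bar>amplitude b n t\<bar> \<le> 2" for b
    using mult_left_mono[OF *, of "n\<^sup>2" b] e by simp
  show "(2 * n)\<^sup>2 * \<bar>amplitude b n t\<bar> \<le> 3000"
  proof -
    have "(2 * n)\<^sup>2 * \<bar>amplitude b n t\<bar> = 4 * (n\<^sup>2 * \<bar>amplitude b n t\<bar>)" by (simp add: power2_eq_square)
    with 2[of b] show ?thesis by linarith
  qed
  have "\<bar>amplitude1 b n t\<bar> \<le> 20 * n * exp (- n)"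
    using dying_bounds(2)[OF n t] born_bounds(2)[OF n t] by (simp add: amplitude1_def)
  then have "2 * n * \<bar>amplitude1 b n t\<bar> \<le> 2 * n * (20 * n * exp (- n))"
    using n by (intro mult_left_mono) auto
  also have "\<dots> = 40 * (n\<^sup>2 * exp (- n))" by (simp add: power2_eq_square)
  finally show "2 * n * \<bar>amplitude1 b n t\<bar> \<le> 3000" using e by linarith
  have w: "(wave b n)\<^sup>2 \<le> 4 * n\<^sup>2" "0 \<le> wave b n * wave (\<not> b) n / 2" "wave b n * wave (\<not> b) n / 2 \<le> n\<^sup>2"
    using n by (auto simp: wave_def power2_eq_square)
  have "\<bar>(wave b n)\<^sup>2 * diag b n t * amplitude b n t\<bar> \<le> 4 * n\<^sup>2 * 300 * \<bar>amplitude b n t\<bar>"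
    unfolding abs_mult using w diag_bounds[OF n, of b t] by (intro mult_mono) auto
  also have "\<dots> \<le> 2400" using 2[of b] by linarith
  finally have "\<bar>(wave b n)\<^sup>2 * diag b n t * amplitude b n t\<bar> \<le> 2400" .
  moreover have "\<bar>wave b n * wave (\<not> b) n / 2 * coupling (\<not> b) n t * amplitude (\<not> b) n t\<bar> \<le> n\<^sup>2 * 1 * \<bar>amplitude (\<not> b) n t\<bar>"
    unfolding abs_mult[of "_ * _"] abs_mult[of "_ / 2"]
    using w coupling_bounds(2)[OF n t, of "\<not> b"] by (intro mult_mono) auto
  with 2[of "\<not> b"] have "\<bar>wave b n * wave (\<not> b) n / 2 * coupling (\<not> b) n t * amplitude (\<not> b) n t\<bar> \<le> 2" by linarith
  ultimately show "\<bar>amplitude2 b n t\<bar> \<le> 3000" unfolding amplitude2_def by linarith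
qed

lemma diag_coupling_overlap:
  assumes "5 \<le> t" "t \<le> 6"
  shows "diag b n t = 1" "diag b n (t - 5) = 1" "coupling b n t = 0" "coupling b n (t - 5) = 0"
  using assms by (auto simp: diag_def coupling_def coefficients_trivial)

text \<open>Integer values give 2 pi-periodic modes. Starting at 1000 keeps the oscillating entries
  below 1/10 and the diagonal above 4/5, as ellipticity requires.\<close>

definition freq :: "nat \<Rightarrow> real" where
  "freq k = 1000 * 2 ^ k"

lemma freq_ge: "1000 \<le> freq k"
  by (simp add: freq_def)

lemma freq_Suc: "freq (Suc k) = 2 * freq k"
  by (simp add: freq_def)

definition stage :: "real^3 \<Rightarrow> nat" where
  "stage p = nat \<lfloor>p $ 3 / 5\<rfloor>"

text \<open>Consecutive slabs overlap in a time interval of length 1, in which the coefficient matrix is the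
  identity and only one mode is present; so the formulas of both stages agree there.\<close>
definition slab :: "nat \<Rightarrow> (real^3) set" where
  "slab k = {p. 5 * real k < p $ 3 \<and> p $ 3 < 5 * real k + 6}"

lemma open_slab: "open (slab k)"
proof -
  have "slab k = {p. 5 * real k < p $ 3} \<inter> {p. p $ 3 < 5 * real k + 6}" by (auto simp: slab_def)
  then show ?thesis by (auto intro!: open_Int open_Collect_less continuous_intros)
qed

lemma cyl_subset_slabs: "cyl \<subseteq> (\<Union>k. slab k)"
proof
  fix p :: "real^3" assume "p \<in> cyl"
  then have t: "0 < p $ 3" by (simp add: cyl_def)
  \<comment> \<open>Not the floor: slabs are open on the left, so a point at time 5 m with m \<ge> 1
    must be put into slab m - 1.\<close>
  define k where "k = nat (\<lceil>p $ 3 / 5\<rceil> - 1)"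
  have "real k = \<lceil>p $ 3 / 5\<rceil> - 1" using t unfolding k_def by (simp add: less_ceiling_iff)
  then have "5 * real k < p $ 3 \<and> p $ 3 < 5 * real k + 6"
    using ceiling_correct[of "p $ 3 / 5"] by linarith
  then show "p \<in> (\<Union>k. slab k)" by (auto simp: slab_def)
qed

lemma stage_cases:
  assumes "p \<in> slab k"
  obtains "stage p = k" | "stage p = Suc k" "5 \<le> p $ 3 - 5 * real k" "p $ 3 - 5 * real k \<le> 6"
proof -
  have p: "5 * real k < p $ 3" "p $ 3 < 5 * real k + 6" using assms by (auto simp: slab_def)
  show thesis
  proof (cases "p $ 3 < 5 * real k + 5")
    case True
    then have "\<lfloor>p $ 3 / 5\<rfloor> = int k" using p by (simp add: floor_eq_iff)
    then show thesis using that(1) by (simp add: stage_def)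
  next
    case False
    then have "\<lfloor>p $ 3 / 5\<rfloor> = int (Suc k)" using p by (simp add: floor_eq_iff)
    then show thesis using that(2) p False by (simp add: stage_def)
  qed
qed

section \<open>The solution and the coefficient matrix, by stages and glued\<close>

definition ustage :: "nat \<Rightarrow> real^3 \<Rightarrow> real" where
  "ustage k p =
     trigprod (5 * real k) (amplitude (even k) (freq k)) (wave (even k) (freq k)) 0 0 0 p
     + trigprod (5 * real k) (amplitude (odd k) (freq k)) 0 0 (wave (odd k) (freq k)) 0 p"

definition Adiag :: "nat \<Rightarrow> 3 \<Rightarrow> 3 \<Rightarrow> real \<Rightarrow> real" where
  "Adiag k i j t = (if i \<noteq> j then 0 else if i = 1 then diag (even k) (freq k) t
     else if i = 2 then diag (odd k) (freq k) t else 1)"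

text \<open>The coupling is chosen by the column, since column \<open>j\<close> multiplies
  \<open>pd j u\<close> and each mode depends on only one of x and y: column 1 acts on the x-mode
  alone, column 2 on the y-mode alone.\<close>

definition Aosc :: "nat \<Rightarrow> 3 \<Rightarrow> 3 \<Rightarrow> real \<Rightarrow> real" where
  "Aosc k i j t = (if i = 3 \<or> j = 3 then 0
     else (if i \<noteq> j then 1
           else if i = 1 then wave (odd k) (freq k) / (2 * wave (even k) (freq k))
           else wave (even k) (freq k) / (2 * wave (odd k) (freq k)))
       * coupling (if j = 1 then even k else odd k) (freq k) t)"

text \<open>The shift by - pi/2 turns cosines into sines: products of cosines on the diagonal,
  products of sines off it.\<close>

definition Aphase :: "3 \<Rightarrow> 3 \<Rightarrow> real" where
  "Aphase i j = (if i = j then 0 else - pi/2)"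

definition Astage :: "nat \<Rightarrow> 3 \<Rightarrow> 3 \<Rightarrow> real^3 \<Rightarrow> real" where
  "Astage k i j p = trigprod (5 * real k) (Adiag k i j) 0 0 0 0 p
     + trigprod (5 * real k) (Aosc k i j) (wave (even k) (freq k)) (Aphase i j) (wave (odd k) (freq k)) (Aphase i j) p"

definition usol :: "real^3 \<Rightarrow> real" where
  "usol p = ustage (stage p) p"

definition Asol :: "real^3 \<Rightarrow> real^3^3" where
  "Asol p = (\<chi> i j. Astage (stage p) i j p)"

text \<open>In the overlap the old mode of stage \<open>k\<close> is gone, the new mode of the next
  stage has not started, and the remaining mode is described by both formulas through
  \<open>born_eq_dying\<close>. The change of parity keeps it on the same coordinate.\<close>

lemma usol_eq: "p \<in> slab k \<Longrightarrow> usol p = ustage k p"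
proof (erule stage_cases)
  assume k: "stage p = Suc k" and t: "5 \<le> p $ 3 - 5 * real k" "p $ 3 - 5 * real k \<le> 6"
  define s where "s = p $ 3 - 5 * real k"
  then have p: "p $ 3 = s + 5 * real k" by simp
  have s: "5 \<le> s" "s \<le> 6" using t by (simp_all add: s_def)
  from k p show ?thesis
    using s
    by (auto simp: usol_def ustage_def trigprod_def wave_def freq_Suc amplitude_def dying_eq_0 born_eq_0 born_eq_dying)
qed (simp add: usol_def)

lemma Asol_eq: "p \<in> slab k \<Longrightarrow> Asol p $ i $ j = Astage k i j p"
proof (erule stage_cases)
  assume k: "stage p = Suc k" and t: "5 \<le> p $ 3 - 5 * real k" "p $ 3 - 5 * real k \<le> 6"
  define s where "s = p $ 3 - 5 * real k"
  then have p: "p $ 3 = s + 5 * real k" by simp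
  have s: "5 \<le> s" "s \<le> 6" using t by (simp_all add: s_def)
  from k p show ?thesis
    by (auto simp: Asol_def Astage_def trigprod_def Adiag_def Aosc_def diag_coupling_overlap[OF s])
qed (simp add: Asol_def)

section \<open>Uniform regularity of the solution and of the matrix\<close>

lemma has_partials_on_mode:
  assumes "\<bar>\<alpha>\<bar> \<le> 2 * freq k" "\<bar>\<beta>\<bar> \<le> 2 * freq k"
  shows "has_partials_on (slab k) (trigprod (5 * real k) (amplitude b (freq k)) \<alpha> \<phi> \<beta> \<psi>)
      (trigprod_pd (5 * real k) (amplitude b (freq k)) (amplitude1 b (freq k)) \<alpha> \<phi> \<beta> \<psi>) 3000"
    and "\<exists>d. has_partials_on (slab k)
      (trigprod_pd (5 * real k) (amplitude b (freq k)) (amplitude1 b (freq k)) \<alpha> \<phi> \<beta> \<psi> l) d 3000"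
proof -
  have n: "0 < freq k" "1 \<le> 2 * freq k" using freq_ge[of k] by linarith+
  have s: "p $ 3 - 5 * real k \<in> {0..6}" if "p \<in> slab k" for p using that by (auto simp: slab_def)
  have b: "(2 * freq k)\<^sup>2 * \<bar>amplitude b (freq k) t\<bar> \<le> 3000 \<and> 2 * freq k * \<bar>amplitude1 b (freq k) t\<bar> \<le> 3000
      \<and> \<bar>amplitude2 b (freq k) t\<bar> \<le> 3000" if "t \<in> {0..6}" for t
    using amplitude_bounds[OF freq_ge[of k], of t b] that by auto
  note * = has_partials_on_trigprod_pd[OF DERIV_amplitude DERIV_amplitude1[OF n(1)] continuous_on_amplitude_diag_coupling(1)
      n(2) assms b s]
  show "has_partials_on (slab k) (trigprod (5 * real k) (amplitude b (freq k)) \<alpha> \<phi> \<beta> \<psi>)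
      (trigprod_pd (5 * real k) (amplitude b (freq k)) (amplitude1 b (freq k)) \<alpha> \<phi> \<beta> \<psi>) 3000"
    by (rule *(1))
  show "\<exists>d. has_partials_on (slab k)
      (trigprod_pd (5 * real k) (amplitude b (freq k)) (amplitude1 b (freq k)) \<alpha> \<phi> \<beta> \<psi> l) d 3000"
    by (rule *(2))
qed

definition ustage_pd :: "nat \<Rightarrow> 3 \<Rightarrow> real^3 \<Rightarrow> real" where
  "ustage_pd k l p =
     trigprod_pd (5 * real k) (amplitude (even k) (freq k)) (amplitude1 (even k) (freq k)) (wave (even k) (freq k)) 0 0 0 l p
     + trigprod_pd (5 * real k) (amplitude (odd k) (freq k)) (amplitude1 (odd k) (freq k)) 0 0 (wave (odd k) (freq k)) 0 l p"

lemma abs_wave_le: "\<bar>wave b (freq k)\<bar> \<le> 2 * freq k"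
  using freq_ge[of k] by (simp add: wave_def)

text \<open>The gluing lemma is applied twice: to \<open>ustage\<close>, and then to the local
  formulas \<open>ustage_pd\<close> that the first application provides for the partial
  derivatives.\<close>

lemma usol_pd: "p \<in> slab k \<Longrightarrow> pd l usol p = ustage_pd k l p"
  and usol_C2: "uniformly_C2_on cyl usol"
proof -
  have zero: "\<bar>0\<bar> \<le> 2 * freq k" for k using freq_ge[of k] by simp
  have "has_partials_on (slab k) (ustage k) (ustage_pd k) (3000 + 3000)" for k
    unfolding ustage_def[abs_def] ustage_pd_def[abs_def]
    by (intro has_partials_on_add has_partials_on_mode(1) abs_wave_le zero)
  note * = uniformly_C1_on_local[OF open_slab cyl_subset_slabs usol_eq this]
  show "p \<in> slab k \<Longrightarrow> pd l usol p = ustage_pd k l p" by (rule *(1))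
  have "uniformly_C1_on cyl (pd l usol)" for l
  proof -
    have "\<exists>d. has_partials_on (slab k) (ustage_pd k l) d (3000 + 3000)" for k
    proof -
      obtain d1 where d1: "has_partials_on (slab k) (trigprod_pd (5 * real k) (amplitude (even k) (freq k))
          (amplitude1 (even k) (freq k)) (wave (even k) (freq k)) 0 0 0 l) d1 3000"
        using has_partials_on_mode(2)[OF abs_wave_le zero] by blast
      obtain d2 where d2: "has_partials_on (slab k) (trigprod_pd (5 * real k) (amplitude (odd k) (freq k))
          (amplitude1 (odd k) (freq k)) 0 0 (wave (odd k) (freq k)) 0 l) d2 3000"
        using has_partials_on_mode(2)[OF zero abs_wave_le] by blast
      show ?thesis
        unfolding ustage_pd_def[abs_def] using has_partials_on_add[OF d1 d2] by blast
    qed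
    then obtain d where d: "\<And>k. has_partials_on (slab k) (ustage_pd k l) (d k) (3000 + 3000)" by metis
    show ?thesis by (rule uniformly_C1_on_local(2)[OF open_slab cyl_subset_slabs *(1) d])
  qed
  with *(2) show "uniformly_C2_on cyl usol" by (simp add: uniformly_C2_on_def)
qed

lemma wave_ratio: "0 < n \<Longrightarrow> 0 \<le> wave b n / (2 * wave c n) \<and> wave b n / (2 * wave c n) \<le> 1"
  by (simp add: wave_def)

text \<open>The two frequencies differ by a factor 2, so the ratios on the diagonal are at most 1,
  and bounds for \<open>coupling\<close> carry over to all entries at once.\<close>

lemma Aosc_scaled_coupling:
  obtains r b where "0 \<le> r" "r \<le> 1" "Aosc k i j = (\<lambda>t. r * coupling b (freq k) t)"
proof -
  have n: "0 < freq k" using freq_ge[of k] by linarith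
  define r where "r = (if i = 3 \<or> j = 3 then 0 else if i \<noteq> j then 1
           else if i = 1 then wave (odd k) (freq k) / (2 * wave (even k) (freq k))
           else wave (even k) (freq k) / (2 * wave (odd k) (freq k)))"
  show thesis
  proof (rule that[of r "if j = 1 then even k else odd k"])
    show "0 \<le> r" "r \<le> 1" using wave_ratio[OF n] by (auto simp: r_def)
  qed (auto simp: fun_eq_iff Aosc_def r_def)
qed

lemma Aosc_bounds:
  assumes "0 \<le> t"
  shows "2 * freq k * \<bar>Aosc k i j t\<bar> \<le> 200" "\<bar>Aosc k i j t\<bar> \<le> 1/10"
proof -
  obtain r b where r: "0 \<le> r" "r \<le> 1" and A: "Aosc k i j = (\<lambda>t. r * coupling b (freq k) t)"
    by (rule Aosc_scaled_coupling)
  have "\<bar>Aosc k i j t\<bar> \<le> 1 * \<bar>coupling b (freq k) t\<bar>"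
    unfolding A abs_mult using r by (intro mult_mono) auto
  moreover from this have "2 * freq k * \<bar>Aosc k i j t\<bar> \<le> 2 * freq k * \<bar>coupling b (freq k) t\<bar>"
    using freq_ge[of k] by (intro mult_left_mono) auto
  ultimately show "2 * freq k * \<bar>Aosc k i j t\<bar> \<le> 200" "\<bar>Aosc k i j t\<bar> \<le> 1/10"
    using coupling_bounds(1,2)[OF freq_ge[of k] assms, of b] by linarith+
qed

lemma Asol_C1: "uniformly_C1_on cyl (\<lambda>p. Asol p $ i $ j)"
proof -
  have n: "0 < freq k" "1 \<le> 2 * freq k" for k using freq_ge[of k] by linarith+
  have s: "p $ 3 - 5 * real k \<in> {0..6}" if "p \<in> slab k" for p k using that by (auto simp: slab_def)
  have "\<exists>d. has_partials_on (slab k) (Astage k i j) d (10000 + 10000)" for k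
  proof -
    define D where "D t = (if i \<noteq> j \<or> i = 3 then 0 else diag1 (if i = 1 then even k else odd k) (freq k) t)" for t
    have "has_partials_on (slab k) (trigprod (5 * real k) (Adiag k i j) 0 0 0 0)
       (trigprod_pd (5 * real k) (Adiag k i j) D 0 0 0 0) 10000"
    proof (rule has_partials_on_trigprod[OF _ _ _ s])
      show "(Adiag k i j has_real_derivative D t) (at t)" for t
        using DERIV_diag[OF n(1)[of k]] exhaust_3[of i] unfolding Adiag_def[abs_def] D_def by auto
      show "continuous_on UNIV D"
        using continuous_on_amplitude_diag_coupling(2) unfolding D_def[abs_def]
        by (cases "i \<noteq> j \<or> i = 3") auto
      show "\<bar>Adiag k i j t\<bar> \<le> 10000 \<and> \<bar>0 * Adiag k i j t\<bar> \<le> 10000 \<and> \<bar>0 * Adiag k i j t\<bar> \<le> 10000 \<and> \<bar>D t\<bar> \<le> 10000"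
        for t
        using diag_bounds[OF freq_ge[of k], of "even k" t] diag_bounds[OF freq_ge[of k], of "odd k" t]
        by (auto simp: Adiag_def D_def)
    qed
    moreover
    obtain r b where r: "0 \<le> r" "r \<le> 1" and A: "Aosc k i j = (\<lambda>t. r * coupling b (freq k) t)"
      by (rule Aosc_scaled_coupling)
    define D' where "D' t = r * coupling1 b (freq k) t" for t
    have "has_partials_on (slab k) (trigprod (5 * real k) (Aosc k i j) (wave (even k) (freq k)) (Aphase i j) (wave (odd k) (freq k)) (Aphase i j))
       (trigprod_pd (5 * real k) (Aosc k i j) D' (wave (even k) (freq k)) (Aphase i j) (wave (odd k) (freq k)) (Aphase i j)) 10000"
    proof (rule has_partials_on_trigprod[OF _ _ _ s])
      show "(Aosc k i j has_real_derivative D' t) (at t)" for t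
        unfolding A D'_def by (intro DERIV_cmult DERIV_coupling n)
      show "continuous_on UNIV D'"
        unfolding D'_def[abs_def] by (intro continuous_intros continuous_on_amplitude_diag_coupling)
      fix t :: real assume t: "t \<in> {0..6}"
      have D': "\<bar>D' t\<bar> \<le> 1 * \<bar>coupling1 b (freq k) t\<bar>"
        unfolding D'_def abs_mult using r by (intro mult_mono) auto
      have W: "\<bar>wave b (freq k) * Aosc k i j t\<bar> \<le> 2 * freq k * \<bar>Aosc k i j t\<bar>" for b
        unfolding abs_mult using abs_wave_le by (intro mult_right_mono) auto
      show "\<bar>Aosc k i j t\<bar> \<le> 10000 \<and> \<bar>wave (even k) (freq k) * Aosc k i j t\<bar> \<le> 10000
         \<and> \<bar>wave (odd k) (freq k) * Aosc k i j t\<bar> \<le> 10000 \<and> \<bar>D' t\<bar> \<le> 10000"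
        using t D' W[of "even k"] W[of "odd k"] Aosc_bounds[of t k i j] coupling_bounds(3)[OF freq_ge[of k], of t b]
        by auto
    qed
    ultimately show ?thesis
      unfolding Astage_def[abs_def] using has_partials_on_add by blast
  qed
  then obtain d where "\<And>k. has_partials_on (slab k) (Astage k i j) (d k) (10000 + 10000)" by metis
  from uniformly_C1_on_local(2)[OF open_slab cyl_subset_slabs Asol_eq this] show ?thesis .
qed

section \<open>Uniform ellipticity\<close>

text \<open>The cross term is at most (x^2 + y^2)/10 in absolute value and is dominated by the
  diagonal, whose entries are at least 7/10.\<close>

lemma elliptic_form_bounds:
  fixes x y z :: real
  assumes "7/10 \<le> a" "a \<le> 400" "7/10 \<le> b" "b \<le> 400" "\<bar>c\<bar> \<le> 1/10" "\<bar>d\<bar> \<le> 1/10"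
  shows "(x\<^sup>2 + y\<^sup>2 + z\<^sup>2) / 1000 \<le> a * x\<^sup>2 + (c + d) * (x * y) + b * y\<^sup>2 + z\<^sup>2"
    "a * x\<^sup>2 + (c + d) * (x * y) + b * y\<^sup>2 + z\<^sup>2 \<le> 1000 * (x\<^sup>2 + y\<^sup>2 + z\<^sup>2)"
proof -
  have "2 * \<bar>x * y\<bar> \<le> x\<^sup>2 + y\<^sup>2"
    using sum_squares_bound[of x y] sum_squares_bound[of x "- y"] by (simp add: abs_if mult.assoc)
  moreover have "\<bar>(c + d) * (x * y)\<bar> \<le> 2/10 * \<bar>x * y\<bar>"
    unfolding abs_mult[of "c + d"] using assms by (intro mult_right_mono) linarith+
  ultimately have 1: "\<bar>(c + d) * (x * y)\<bar> \<le> (x\<^sup>2 + y\<^sup>2) / 10"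
    by (elim order_trans) simp
  have 2: "7/10 * x\<^sup>2 \<le> a * x\<^sup>2" "a * x\<^sup>2 \<le> 400 * x\<^sup>2" "7/10 * y\<^sup>2 \<le> b * y\<^sup>2" "b * y\<^sup>2 \<le> 400 * y\<^sup>2"
    by (intro mult_right_mono; use assms in simp)+
  have 3: "0 \<le> x\<^sup>2" "0 \<le> y\<^sup>2" "0 \<le> z\<^sup>2" by auto
  \<comment> \<open>With variables in place of the squares and products the claim is linear.\<close>
  have *: "(X + Y + Z) / 1000 \<le> A + w + B + Z \<and> A + w + B + Z \<le> 1000 * (X + Y + Z)"
    if "\<bar>w\<bar> \<le> (X + Y) / 10" "7/10 * X \<le> A" "A \<le> 400 * X" "7/10 * Y \<le> B" "B \<le> 400 * Y"
      "0 \<le> X" "0 \<le> Y" "0 \<le> Z" for w X Y Z A B :: real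
    using that by auto
  show "(x\<^sup>2 + y\<^sup>2 + z\<^sup>2) / 1000 \<le> a * x\<^sup>2 + (c + d) * (x * y) + b * y\<^sup>2 + z\<^sup>2"
    "a * x\<^sup>2 + (c + d) * (x * y) + b * y\<^sup>2 + z\<^sup>2 \<le> 1000 * (x\<^sup>2 + y\<^sup>2 + z\<^sup>2)"
    using *[OF 1 2 3] by blast+
qed

lemma Asol_elliptic: "uniformly_elliptic_on cyl Asol"
  unfolding uniformly_elliptic_on_def
proof (intro exI[of _ 1000] conjI ballI allI)
  fix p :: "real^3" and \<xi> :: "real^3" assume "p \<in> cyl"
  then obtain k where k: "p \<in> slab k" using cyl_subset_slabs by auto
  define t where "t = p $ 3 - 5 * real k"
  have t: "0 \<le> t" using k by (auto simp: t_def slab_def)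
  have osc: "\<bar>Asol p $ i $ j - Adiag k i j t\<bar> \<le> 1/10" for i j
    unfolding Asol_eq[OF k] Astage_def
    using abs_trigprod_le[of "Aosc k i j" p "5 * real k" "1/10"] Aosc_bounds(2)[OF t, of k i j]
    by (simp add: trigprod_def t_def)
  have z: "Asol p $ 3 $ 3 = 1" "\<And>i. i \<noteq> 3 \<Longrightarrow> Asol p $ i $ 3 = 0" "\<And>i. i \<noteq> 3 \<Longrightarrow> Asol p $ 3 $ i = 0"
    by (auto simp: Asol_eq[OF k] Astage_def trigprod_def Adiag_def Aosc_def)
  have d: "7/10 \<le> Asol p $ i $ i \<and> Asol p $ i $ i \<le> 400" if "i = 1 \<or> i = 2" for i
  proof -
    have "4/5 \<le> Adiag k i i t" "Adiag k i i t \<le> 300"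
      using that diag_bounds[OF freq_ge] by (auto simp: Adiag_def)
    with osc[of i i] show ?thesis by linarith
  qed
  have od: "\<bar>Asol p $ i $ j\<bar> \<le> 1/10" if "i \<noteq> j" for i j
    using osc[of i j] that by (simp add: Adiag_def)
  have form: "\<xi> \<bullet> (Asol p *v \<xi>) = Asol p $ 1 $ 1 * (\<xi> $ 1)\<^sup>2 + (Asol p $ 1 $ 2 + Asol p $ 2 $ 1) * (\<xi> $ 1 * \<xi> $ 2)
      + Asol p $ 2 $ 2 * (\<xi> $ 2)\<^sup>2 + (\<xi> $ 3)\<^sup>2"
    by (simp add: inner_vec_def matrix_vector_mult_def sum_3 z power2_eq_square algebra_simps)
  have nrm: "(norm \<xi>)\<^sup>2 = (\<xi> $ 1)\<^sup>2 + (\<xi> $ 2)\<^sup>2 + (\<xi> $ 3)\<^sup>2"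
    by (simp only: power2_norm_eq_inner inner_vec_def sum_3) (simp add: power2_eq_square)
  show "(norm \<xi>)\<^sup>2 / 1000 \<le> \<xi> \<bullet> (Asol p *v \<xi>)" "\<xi> \<bullet> (Asol p *v \<xi>) \<le> 1000 * (norm \<xi>)\<^sup>2"
    unfolding form nrm using d[of 1] d[of 2] od[of 1 2] od[of 2 1]
    by (intro elliptic_form_bounds; simp)+
qed simp

section \<open>The equation and the decay\<close>

text \<open>The entries with factor \<kappa> turn the gradient of the x-mode into a multiple of cos (\<beta> y): up to
  this multiple, the x- and y-derivatives of the products produce only cos (2 \<alpha> x) cos (\<beta> y),
  and the factor \<beta> / (2 \<alpha>) makes these terms cancel. Symmetrically for \<mu>.\<close>
lemma div_A_grad_two_modes:
  fixes p :: "real^3"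
  assumes U: "open U" "p \<in> U" and nz: "\<alpha> \<noteq> 0" "\<beta> \<noteq> 0"
    and A: "\<And>q. q \<in> U \<Longrightarrow> A q $ 1 $ 1 = a (q $ 3) + \<beta> / (2 * \<alpha>) * \<kappa> (q $ 3) * cos (\<alpha> * q $ 1) * cos (\<beta> * q $ 2)"
      "\<And>q. q \<in> U \<Longrightarrow> A q $ 2 $ 2 = b (q $ 3) + \<alpha> / (2 * \<beta>) * \<mu> (q $ 3) * cos (\<alpha> * q $ 1) * cos (\<beta> * q $ 2)"
      "\<And>q. q \<in> U \<Longrightarrow> A q $ 1 $ 2 = \<mu> (q $ 3) * sin (\<alpha> * q $ 1) * sin (\<beta> * q $ 2)"
      "\<And>q. q \<in> U \<Longrightarrow> A q $ 2 $ 1 = \<kappa> (q $ 3) * sin (\<alpha> * q $ 1) * sin (\<beta> * q $ 2)"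
      "\<And>q. q \<in> U \<Longrightarrow> A q $ 3 $ 3 = 1"
      "\<And>q i. q \<in> U \<Longrightarrow> i \<noteq> 3 \<Longrightarrow> A q $ i $ 3 = 0 \<and> A q $ 3 $ i = 0"
    and u: "\<And>q. q \<in> U \<Longrightarrow> pd 1 u q = - \<alpha> * f (q $ 3) * sin (\<alpha> * q $ 1)"
      "\<And>q. q \<in> U \<Longrightarrow> pd 2 u q = - \<beta> * g (q $ 3) * sin (\<beta> * q $ 2)"
      "\<And>q. q \<in> U \<Longrightarrow> pd 3 u q = f' (q $ 3) * cos (\<alpha> * q $ 1) + g' (q $ 3) * cos (\<beta> * q $ 2)"
    and f': "(f' has_real_derivative \<alpha>\<^sup>2 * a (p $ 3) * f (p $ 3) + \<alpha> * \<beta> / 2 * \<mu> (p $ 3) * g (p $ 3)) (at (p $ 3))"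
    and g': "(g' has_real_derivative \<beta>\<^sup>2 * b (p $ 3) * g (p $ 3) + \<alpha> * \<beta> / 2 * \<kappa> (p $ 3) * f (p $ 3)) (at (p $ 3))"
  shows "div_A_grad A u p = 0"
proof -
  define V where "V i q = (\<Sum>j\<in>UNIV. A q $ i $ j * pd j u q)" for i :: 3 and q
  define t where "t = p $ 3"
  define x where "x = \<alpha> * p $ 1"
  define y where "y = \<beta> * p $ 2"
  have pd: "pd i (V i) p = D" if "\<And>q. q \<in> U \<Longrightarrow> V i q = W q"
    "((\<lambda>s. W (p + s *\<^sub>R axis i 1)) has_real_derivative D) (at 0)" for i W D
  proof -
    have "\<forall>\<^sub>F s in nhds 0. V i (p + s *\<^sub>R axis i 1) = W (p + s *\<^sub>R axis i 1)"
      by (rule eventually_mono[OF eventually_at_0_axis[OF U] that(1)])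
    with that(2) have "((\<lambda>s. V i (p + s *\<^sub>R axis i 1)) has_real_derivative D) (at 0)"
      by (subst DERIV_cong_ev[OF refl _ refl])
    then show ?thesis unfolding pd_def by (rule DERIV_imp_deriv)
  qed
  \<comment> \<open>Derivative of the flux in x along its own direction. It is used a second time
    for y, with the roles of the two modes exchanged.\<close>
  have cross: "((\<lambda>s. (a + r * \<kappa> * cos (x + \<alpha> * s) * cos y) * (- \<alpha> * f * sin (x + \<alpha> * s))
        + \<mu> * sin (x + \<alpha> * s) * sin y * (- \<beta> * g * sin y)) has_real_derivative
      - (\<alpha>\<^sup>2 * a * f * cos x) + \<alpha> * (r * \<alpha>) * (\<kappa> * f * cos y * ((sin x)\<^sup>2 - (cos x)\<^sup>2))
      - \<alpha> * \<beta> * (\<mu> * g * cos x * (sin y)\<^sup>2)) (at 0)" for a r \<kappa> \<mu> f g \<alpha> \<beta> x y :: real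
    by (rule derivative_eq_intros refl | simp)+ (simp add: power2_eq_square algebra_simps)
  have 1: "pd 1 (V 1) p = - (\<alpha>\<^sup>2 * a t * f t * cos x)
      + \<alpha> * (\<beta> / (2 * \<alpha>) * \<alpha>) * (\<kappa> t * f t * cos y * ((sin x)\<^sup>2 - (cos x)\<^sup>2))
      - \<alpha> * \<beta> * (\<mu> t * g t * cos x * (sin y)\<^sup>2)"
  proof (rule pd)
    show "V 1 q = (a (q $ 3) + \<beta> / (2 * \<alpha>) * \<kappa> (q $ 3) * cos (\<alpha> * q $ 1) * cos (\<beta> * q $ 2)) * (- \<alpha> * f (q $ 3) * sin (\<alpha> * q $ 1))
        + \<mu> (q $ 3) * sin (\<alpha> * q $ 1) * sin (\<beta> * q $ 2) * (- \<beta> * g (q $ 3) * sin (\<beta> * q $ 2))" if "q \<in> U" for q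
      using A[OF that] u[OF that] by (simp add: V_def sum_3)
    have "\<alpha> * (p + s *\<^sub>R axis 1 1) $ 1 = x + \<alpha> * s" "\<beta> * (p + s *\<^sub>R axis 1 1) $ 2 = y"
      "(p + s *\<^sub>R axis 1 1) $ 3 = t" for s
      by (simp_all add: axis_def x_def y_def t_def distrib_left)
    then show "((\<lambda>s. (a ((p + s *\<^sub>R axis 1 1) $ 3) + \<beta> / (2 * \<alpha>) * \<kappa> ((p + s *\<^sub>R axis 1 1) $ 3)
          * cos (\<alpha> * (p + s *\<^sub>R axis 1 1) $ 1) * cos (\<beta> * (p + s *\<^sub>R axis 1 1) $ 2))
          * (- \<alpha> * f ((p + s *\<^sub>R axis 1 1) $ 3) * sin (\<alpha> * (p + s *\<^sub>R axis 1 1) $ 1))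
        + \<mu> ((p + s *\<^sub>R axis 1 1) $ 3) * sin (\<alpha> * (p + s *\<^sub>R axis 1 1) $ 1) * sin (\<beta> * (p + s *\<^sub>R axis 1 1) $ 2)
          * (- \<beta> * g ((p + s *\<^sub>R axis 1 1) $ 3) * sin (\<beta> * (p + s *\<^sub>R axis 1 1) $ 2))) has_real_derivative
        - (\<alpha>\<^sup>2 * a t * f t * cos x)
        + \<alpha> * (\<beta> / (2 * \<alpha>) * \<alpha>) * (\<kappa> t * f t * cos y * ((sin x)\<^sup>2 - (cos x)\<^sup>2))
        - \<alpha> * \<beta> * (\<mu> t * g t * cos x * (sin y)\<^sup>2)) (at 0)"
      using cross[of "a t" "\<beta> / (2 * \<alpha>)" "\<kappa> t" x \<alpha> y "f t" "\<mu> t" \<beta> "g t"] by (simp only:)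
  qed
  have 2: "pd 2 (V 2) p = - (\<beta>\<^sup>2 * b t * g t * cos y)
      + \<beta> * (\<alpha> / (2 * \<beta>) * \<beta>) * (\<mu> t * g t * cos x * ((sin y)\<^sup>2 - (cos y)\<^sup>2))
      - \<beta> * \<alpha> * (\<kappa> t * f t * cos y * (sin x)\<^sup>2)"
  proof (rule pd)
    show "V 2 q = (b (q $ 3) + \<alpha> / (2 * \<beta>) * \<mu> (q $ 3) * cos (\<beta> * q $ 2) * cos (\<alpha> * q $ 1)) * (- \<beta> * g (q $ 3) * sin (\<beta> * q $ 2))
        + \<kappa> (q $ 3) * sin (\<beta> * q $ 2) * sin (\<alpha> * q $ 1) * (- \<alpha> * f (q $ 3) * sin (\<alpha> * q $ 1))" if "q \<in> U" for q
      using A[OF that] u[OF that] by (simp add: V_def sum_3 mult_ac)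
    have "\<alpha> * (p + s *\<^sub>R axis 2 1) $ 1 = x" "\<beta> * (p + s *\<^sub>R axis 2 1) $ 2 = y + \<beta> * s"
      "(p + s *\<^sub>R axis 2 1) $ 3 = t" for s
      by (simp_all add: axis_def x_def y_def t_def distrib_left)
    then show "((\<lambda>s. (b ((p + s *\<^sub>R axis 2 1) $ 3) + \<alpha> / (2 * \<beta>) * \<mu> ((p + s *\<^sub>R axis 2 1) $ 3)
          * cos (\<beta> * (p + s *\<^sub>R axis 2 1) $ 2) * cos (\<alpha> * (p + s *\<^sub>R axis 2 1) $ 1))
          * (- \<beta> * g ((p + s *\<^sub>R axis 2 1) $ 3) * sin (\<beta> * (p + s *\<^sub>R axis 2 1) $ 2))
        + \<kappa> ((p + s *\<^sub>R axis 2 1) $ 3) * sin (\<beta> * (p + s *\<^sub>R axis 2 1) $ 2) * sin (\<alpha> * (p + s *\<^sub>R axis 2 1) $ 1)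
          * (- \<alpha> * f ((p + s *\<^sub>R axis 2 1) $ 3) * sin (\<alpha> * (p + s *\<^sub>R axis 2 1) $ 1))) has_real_derivative
        - (\<beta>\<^sup>2 * b t * g t * cos y)
        + \<beta> * (\<alpha> / (2 * \<beta>) * \<beta>) * (\<mu> t * g t * cos x * ((sin y)\<^sup>2 - (cos y)\<^sup>2))
        - \<beta> * \<alpha> * (\<kappa> t * f t * cos y * (sin x)\<^sup>2)) (at 0)"
      using cross[of "b t" "\<alpha> / (2 * \<beta>)" "\<mu> t" y \<beta> x "g t" "\<kappa> t" \<alpha> "f t"] by (simp only:)
  qed
  have shift: "((\<lambda>s. h (p $ 3 + s)) has_real_derivative D) (at 0)"
    if "(h has_real_derivative D) (at (p $ 3))" for h :: "real \<Rightarrow> real" and D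
    using that DERIV_shift[of h D 0 "p $ 3"] by (simp add: add.commute)
  have 3: "pd 3 (V 3) p = (\<alpha>\<^sup>2 * a t * f t + \<alpha> * \<beta> / 2 * \<mu> t * g t) * cos x
      + (\<beta>\<^sup>2 * b t * g t + \<alpha> * \<beta> / 2 * \<kappa> t * f t) * cos y"
  proof (rule pd)
    show "V 3 q = f' (q $ 3) * cos (\<alpha> * q $ 1) + g' (q $ 3) * cos (\<beta> * q $ 2)" if "q \<in> U" for q
      using A[OF that] u[OF that] by (simp add: V_def sum_3)
    have "((\<lambda>s. f' (p $ 3 + s) * cos x + g' (p $ 3 + s) * cos y) has_real_derivative
      (\<alpha>\<^sup>2 * a t * f t + \<alpha> * \<beta> / 2 * \<mu> t * g t) * cos x
      + (\<beta>\<^sup>2 * b t * g t + \<alpha> * \<beta> / 2 * \<kappa> t * f t) * cos y) (at 0)"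
      unfolding t_def by (intro DERIV_add DERIV_cmult_right shift f' g')
    then show "((\<lambda>s. f' ((p + s *\<^sub>R axis 3 1) $ 3) * cos (\<alpha> * (p + s *\<^sub>R axis 3 1) $ 1)
      + g' ((p + s *\<^sub>R axis 3 1) $ 3) * cos (\<beta> * (p + s *\<^sub>R axis 3 1) $ 2)) has_real_derivative
      (\<alpha>\<^sup>2 * a t * f t + \<alpha> * \<beta> / 2 * \<mu> t * g t) * cos x
      + (\<beta>\<^sup>2 * b t * g t + \<alpha> * \<beta> / 2 * \<kappa> t * f t) * cos y) (at 0)"
      by (simp add: axis_def x_def y_def)
  qed
  have "div_A_grad A u p = pd 1 (V 1) p + pd 2 (V 2) p + pd 3 (V 3) p"
    by (simp add: div_A_grad_def V_def[abs_def] sum_3)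
  also have "\<dots> = 0"
  proof -
    \<comment> \<open>The factor of \<kappa> f cos y from the first two fluxes is \<alpha> \<beta>/2
      (sin^2 x - cos^2 x) - \<alpha> \<beta> sin^2 x = - \<alpha> \<beta>/2, which the coupling term
      in the equation for g cancels; likewise for \<mu>.\<close>
    have sx: "(sin x)\<^sup>2 = 1 - (cos x)\<^sup>2" and sy: "(sin y)\<^sup>2 = 1 - (cos y)\<^sup>2" by (simp_all add: sin_squared_eq)
    have r: "\<beta> / (2 * \<alpha>) * \<alpha> = \<beta> / 2" "\<alpha> / (2 * \<beta>) * \<beta> = \<alpha> / 2"
      using nz by simp_all
    show ?thesis unfolding 1 2 3 r sx sy by (simp add: field_simps)
  qed
  finally show ?thesis .
qed

lemma div_A_grad_Asol:
  assumes "p \<in> cyl"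
  shows "div_A_grad Asol usol p = 0"
proof -
  obtain k where k: "p \<in> slab k" using assms cyl_subset_slabs by auto
  define n where "n = freq k"
  define e where "e = even k"
  define c where "c = 5 * real k"
  have n: "0 < n" using freq_ge[of k] by (simp add: n_def)
  have shift: "((\<lambda>s. amplitude1 b n (s - c)) has_real_derivative amplitude2 b n (t - c)) (at t)" for b t
  proof -
    have "((\<lambda>s. s - c) has_real_derivative 1) (at t)" by (auto intro!: derivative_eq_intros)
    from DERIV_chain2[OF _ this, of "amplitude1 b n"] DERIV_amplitude1[OF n] show ?thesis by simp
  qed
  have f: "((\<lambda>s. amplitude1 e n (s - c)) has_real_derivative
      (wave e n)\<^sup>2 * diag e n (t - c) * amplitude e n (t - c)
      + wave e n * wave (\<not> e) n / 2 * coupling (\<not> e) n (t - c) * amplitude (\<not> e) n (t - c)) (at t)" for t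
    using shift[of e t] by (simp add: amplitude2_def)
  have g: "((\<lambda>s. amplitude1 (\<not> e) n (s - c)) has_real_derivative
      (wave (\<not> e) n)\<^sup>2 * diag (\<not> e) n (t - c) * amplitude (\<not> e) n (t - c)
      + wave e n * wave (\<not> e) n / 2 * coupling e n (t - c) * amplitude e n (t - c)) (at t)" for t
    using shift[of "\<not> e" t] by (simp add: amplitude2_def mult.commute)
  note defs = Astage_def trigprod_def Adiag_def Aosc_def Aphase_def ustage_pd_def trigprod_pd_def cos_add cos_diff
    n_def e_def c_def
  show ?thesis
  proof (rule div_A_grad_two_modes[OF open_slab k, where \<alpha> = "wave e n" and \<beta> = "wave (\<not> e) n"
        and a = "\<lambda>t. diag e n (t - c)" and b = "\<lambda>t. diag (\<not> e) n (t - c)"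
        and \<kappa> = "\<lambda>t. coupling e n (t - c)" and \<mu> = "\<lambda>t. coupling (\<not> e) n (t - c)"
        and f = "\<lambda>t. amplitude e n (t - c)" and g = "\<lambda>t. amplitude (\<not> e) n (t - c)"
        and f' = "\<lambda>t. amplitude1 e n (t - c)" and g' = "\<lambda>t. amplitude1 (\<not> e) n (t - c)", OF _ _ _ _ _ _ _ _ _ _ _ f g])
    show "wave e n \<noteq> 0" "wave (\<not> e) n \<noteq> 0" using n by (simp_all add: wave_def)
    fix q assume q: "q \<in> slab k"
    note A = Asol_eq[OF q] and u = usol_pd[OF q]
    show "Asol q $ 1 $ 1 = diag e n (q $ 3 - c) + wave (\<not> e) n / (2 * wave e n) * coupling e n (q $ 3 - c)
        * cos (wave e n * q $ 1) * cos (wave (\<not> e) n * q $ 2)"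
      "Asol q $ 2 $ 2 = diag (\<not> e) n (q $ 3 - c) + wave e n / (2 * wave (\<not> e) n) * coupling (\<not> e) n (q $ 3 - c)
        * cos (wave e n * q $ 1) * cos (wave (\<not> e) n * q $ 2)"
      "Asol q $ 1 $ 2 = coupling (\<not> e) n (q $ 3 - c) * sin (wave e n * q $ 1) * sin (wave (\<not> e) n * q $ 2)"
      "Asol q $ 2 $ 1 = coupling e n (q $ 3 - c) * sin (wave e n * q $ 1) * sin (wave (\<not> e) n * q $ 2)"
      "Asol q $ 3 $ 3 = 1"
      unfolding A by (simp_all add: defs)
    show "Asol q $ i $ 3 = 0 \<and> Asol q $ 3 $ i = 0" if "i \<noteq> 3" for i
      unfolding A using that by (simp add: defs)
    show "pd 1 usol q = - wave e n * amplitude e n (q $ 3 - c) * sin (wave e n * q $ 1)"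
      "pd 2 usol q = - wave (\<not> e) n * amplitude (\<not> e) n (q $ 3 - c) * sin (wave (\<not> e) n * q $ 2)"
      "pd 3 usol q = amplitude1 e n (q $ 3 - c) * cos (wave e n * q $ 1)
        + amplitude1 (\<not> e) n (q $ 3 - c) * cos (wave (\<not> e) n * q $ 2)"
      unfolding u by (simp_all add: defs)
  qed
qed

section \<open>Periodicity, decay and non-triviality\<close>

lemma cos_wave_periodic: "cos (wave b (freq k) * (x + 2 * pi) + \<phi>) = cos (wave b (freq k) * x + \<phi>)"
proof -
  have int: "wave b (freq k) \<in> \<int>" by (auto simp: wave_def freq_def)
  have "wave b (freq k) * (x + 2 * pi) + \<phi> = wave b (freq k) * x + \<phi> + 2 * pi * wave b (freq k)"
    by (simp add: algebra_simps)
  then show ?thesis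
    by (simp only: cos_add[of _ "2 * pi * wave b (freq k)"] cos_integer_2pi[OF int] sin_integer_2pi[OF int] mult_1_right mult_zero_right diff_zero)
qed

lemma periodic_sol: "periodic_xy usol" "periodic_xy Asol"
proof -
  note per = cos_wave_periodic cos_wave_periodic[where \<phi> = 0, simplified]
  have 1: "(p + (2 * pi) *\<^sub>R axis 1 1) $ 1 = p $ 1 + 2 * pi" "(p + (2 * pi) *\<^sub>R axis 1 1) $ 2 = p $ 2"
    "(p + (2 * pi) *\<^sub>R axis 1 1) $ 3 = p $ 3" "(p + (2 * pi) *\<^sub>R axis 2 1) $ 1 = p $ 1"
    "(p + (2 * pi) *\<^sub>R axis 2 1) $ 2 = p $ 2 + 2 * pi" "(p + (2 * pi) *\<^sub>R axis 2 1) $ 3 = p $ 3" for p :: "real^3"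
    by (simp_all add: axis_def)
  show "periodic_xy usol"
    unfolding periodic_xy_def usol_def ustage_def trigprod_def stage_def 1 by (simp add: per)
  show "periodic_xy Asol"
    unfolding periodic_xy_def Asol_def Astage_def trigprod_def stage_def 1 by (simp add: per)
qed

text \<open>At time t < 5 (k + 1) the frequency 1000 * 2^k exceeds 500 * 2^(t/5), and each of the
  two modes is at most exp (- \<open>freq k\<close>).\<close>

lemma usol_decay:
  assumes p: "p \<in> cyl"
  shows "\<bar>usol p\<bar> \<le> 2 * exp (- 500 * exp (ln 2 / 5 * p $ 3))"
proof -
  have t: "0 < p $ 3" using p by (simp add: cyl_def)
  define k where "k = stage p"
  have "real k = \<lfloor>p $ 3 / 5\<rfloor>" using t by (simp add: k_def stage_def)
  then have k: "real k \<le> p $ 3 / 5" "p $ 3 / 5 < real k + 1"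
    using floor_correct[of "p $ 3 / 5"] by linarith+
  have 1: "\<bar>amplitude b (freq k) (p $ 3 - 5 * real k)\<bar> \<le> exp (- freq k)" for b
    using amplitude_bounds(1)[OF freq_ge] k by simp
  have "\<bar>usol p\<bar> \<le> exp (- freq k) + exp (- freq k)"
    unfolding usol_def ustage_def k_def[symmetric]
    by (intro order_trans[OF abs_triangle_ineq add_mono] abs_trigprod_le 1)
  moreover have "500 * exp (ln 2 / 5 * p $ 3) \<le> freq k"
  proof -
    have "exp (ln 2 / 5 * p $ 3) \<le> exp (ln 2 * (real k + 1))"
    proof -
      have "ln 2 * (p $ 3 / 5) \<le> ln 2 * (real k + 1)" using k by (intro mult_left_mono) auto
      then show ?thesis by simp
    qed
    also have "\<dots> = 2 powr (real k + 1)" by (simp add: powr_def mult.commute)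
    also have "\<dots> = 2 * 2 ^ k" by (simp add: powr_add powr_realpow)
    finally show ?thesis by (simp add: freq_def)
  qed
  then have "exp (- freq k) \<le> exp (- 500 * exp (ln 2 / 5 * p $ 3))" by simp
  ultimately show ?thesis by linarith
qed

lemma usol_nonzero: "\<exists>p\<in>cyl. usol p \<noteq> 0"
proof
  \<comment> \<open>At time 1 of stage 0 the new mode is still zero, and at x = 0 the cosine of the
    old mode is 1.\<close>
  define p :: "real^3" where "p = axis 3 1"
  have p: "p $ 1 = 0" "p $ 2 = 0" "p $ 3 = 1" by (simp_all add: p_def axis_def)
  then show "p \<in> cyl" by (simp add: cyl_def)
  have "stage p = 0" using p by (simp add: stage_def)
  then show "usol p \<noteq> 0"
    by (simp add: usol_def ustage_def trigprod_def p amplitude_def born_eq_0 dying_def smoothstep_eq_0)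
qed

theorem theorem1p1:
  shows "\<exists>(A :: real^3 \<Rightarrow> real^3^3) (u :: real^3 \<Rightarrow> real).
    periodic_xy A \<and> periodic_xy u \<and>
    uniformly_elliptic_on cyl A \<and>
    (\<forall>i j. uniformly_C1_on cyl (\<lambda>p. A p $ i $ j)) \<and>
    uniformly_C2_on cyl u \<and>
    (\<exists>p\<in>cyl. u p \<noteq> 0) \<and>
    (\<forall>p\<in>cyl. div_A_grad A u p = 0) \<and>
    (\<exists>c>0. \<exists>C>0. \<exists>T0. \<forall>T\<ge>T0. \<forall>p\<in>cyl. p $ 3 \<ge> T \<longrightarrow>
        \<bar>u p\<bar> \<le> C * exp (- c * exp (c * T)))"
proof (intro exI[of _ Asol] exI[of _ usol] conjI allI ballI)
  define c :: real where "c = ln 2 / 5"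
  \<comment> \<open>The same constant has to serve in both exponents; as c \<le> 500, putting it in
    place of the outer 500 only weakens the bound.\<close>
  have c: "0 < c" "c \<le> 500" using ln_le_minus_one[of "2::real"] by (simp_all add: c_def)
  have "\<bar>usol p\<bar> \<le> 2 * exp (- c * exp (c * T))" if p: "p \<in> cyl" "T \<le> p $ 3" for p T
  proof -
    have "c * exp (c * T) \<le> 500 * exp (c * p $ 3)"
      using c p by (intro mult_mono) auto
    then have "exp (- 500 * exp (c * p $ 3)) \<le> exp (- c * exp (c * T))" by simp
    with usol_decay[OF p(1), folded c_def] show ?thesis by linarith
  qed
  then show "\<exists>c>0. \<exists>C>0. \<exists>T0. \<forall>T\<ge>T0. \<forall>p\<in>cyl. p $ 3 \<ge> T \<longrightarrow> \<bar>usol p\<bar> \<le> C * exp (- c * exp (c * T))"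
    using c(1) by (metis zero_less_numeral)
qed (auto intro: periodic_sol Asol_elliptic Asol_C1 usol_C2 usol_nonzero div_A_grad_Asol)

end
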